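(* Let $f:\mathbb{R}^{n_x}\times\mathbb{R}^{n_u}\to\mathbb{R}^{n_x}$ be continuously differentiable, let $u:[0,T]\to\mathbb{R}^{n_u}$ be a given control function, and let $\mathcal{C}(t)=\{x\in\mathbb{R}^{n_x}\mid c(x,t)\ge 0\}$ with $c:\mathbb{R}^{n_x}\times\mathbb{R}\to\mathbb{R}^{n_c}$, where $c$ is continuously differentiable in $x$ and Lipschitz continuous in $t$, and $t\mapsto\mathcal{C}(t)$ is forward Lipschitz. Assume that $\mathcal{C}(t)$ is uniformly prox-regular and of bounded variation. Define $\hat{c}:\mathbb{R}^{n_x+1}\to\mathbb{R}^{n_c}$ by $\hat{c}(y)=c(x,\tau)$ for $y=(x,\tau)\in\mathbb{R}^{n_x}\times\mathbb{R}$, let $\mathcal{C}=\{y\in\mathbb{R}^{n_x+1}\mid\hat{c}(y)\ge0\}$, let $E=(e_1,\dots,e_{n_x})\in\mathbb{R}^{(n_x+1)\times n_x}$, where $e_i$ is the $i$-th standard basis vector of $\mathbb{R}^{n_x+1}$, and let $\mathcal{E}=\{EE^\top z\mid z\in\mathbb{R}^{n_x+1}\}$. Then the solutions of the perturbed first-order sweeping process $$\dot{x}\in f(x,u)-\mathcal{N}_{\mathcal{C}(t)}(x),\qquad x(0)\in\mathcal{C}(0),$$ correspond to the solutions of the extended projected dynamical system $$\dot{y}=\mathrm{P}_{\mathcal{T}_{\mathcal{C}}(y),\mathcal{E}}\big((f(x,u),1)\big),\qquad y(0)=(x(0),0)\in\mathcal{C},$$ in the sense that a function $x:[0,T]\to\mathbb{R}^{n_x}$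 is a solution of the sweeping process if and only if there exists $\tau:[0,T]\to\mathbb{R}$ such that $y=(x,\tau)$ is a solution of the extended projected dynamical system.
   Context: Inequalities between vectors are componentwise. The tangent cone to a closed set $\mathcal{D}\subseteq\mathbb{R}^n$ at $x\in\mathcal{D}$ is $\mathcal{T}_{\mathcal{D}}(x)=\{d\mid \exists\, x_i\in\mathcal{D},\ t_i>0,\ x_i\to x,\ t_i\to 0,\ d=\lim_{i\to\infty}(x_i-x)/t_i\}$, and the normal cone is $\mathcal{N}_{\mathcal{D}}(x)=\{v\in\mathbb{R}^n\mid\langle v,d\rangle\le0\ \ \forall d\in\mathcal{T}_{\mathcal{D}}(x)\}$; both are empty for $x\notin\mathcal{D}$. For the sets $\mathcal{C}(t)$, it is a standing convention of the setting that the normal cone is given by the constraint gradients: $\mathcal{N}_{\mathcal{C}(t)}(x)=\{-\sum_{i:\,c_i(x,t)=0}\lambda_i\nabla_x c_i(x,t)\mid\lambda_i\ge0\}$ for $x\in\mathcal{C}(t)$. For a set $\mathcal{K}$, a linear subspace $\mathcal{E}$ and a vector $v$, the extended projection is $$\mathrm{P}_{\mathcal{K},\mathcal{E}}(v)=\arg\min_{w}\ \tfrac12\|w-v\|_2^2\quad\text{s.t.}\quad w\in\mathcal{K},\ w-v\in\mathcal{E}.$$ Uniformly prox-regular: there is $r>0$ such that for all $t\in[0,T]$, all $x,x'\in\mathcal{C}(t)$ and all $\zeta\in\mathcal{N}_{\mathcal{C}(t)}(x)$ one has $\langle\zeta,x'-x\rangle\le\frac{\|\zeta\|}{2r}\|x'-x\|^2$.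 Of bounded variation: there is a finite nonnegative Radon measure $\mu$ on $[0,T]$ such that $|d(z,\mathcal{C}(t))-d(z,\mathcal{C}(s))|\le\mu((s,t])$ for all $z\in\mathbb{R}^{n_x}$ and $0\le s\le t\le T$, where $d(z,\cdot)$ is the Euclidean distance to a set. Forward Lipschitz: there is $L\ge0$ such that for all $s\le t$ in $[0,T]$ and all $x\in\mathcal{C}(s)$ there is $x'\in\mathcal{C}(t)$ with $\|x'-x\|\le L(t-s)$. Solutions are absolutely continuous functions on $[0,T]$ that satisfy the differential inclusion (respectively, differential equation) for almost every $t$, with $x(t)\in\mathcal{C}(t)$ (respectively, $y(t)\in\mathcal{C}$) for all $t$. *)

theory Defs
  imports "HOL-Analysis.Analysis"
begin

definition continuously_differentiable ::
  "('a::real_normed_vector \<Rightarrow> 'b::real_normed_vector) \<Rightarrow> bool" where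
  "continuously_differentiable f \<longleftrightarrow>
     (\<exists>f' :: 'a \<Rightarrow> 'a \<Rightarrow>\<^sub>L 'b.
        (\<forall>x. (f has_derivative blinfun_apply (f' x)) (at x)) \<and> continuous_on UNIV f')"

definition gradient :: "('a::real_inner \<Rightarrow> real) \<Rightarrow> 'a \<Rightarrow> 'a" where
  "gradient g x = (THE D. GDERIV g x :> D)"

(* The usual epsilon-delta definition; D ranges over the finite families of non-overlapping
   compact intervals K = [Inf K, Sup K] contained in S. *)
definition absolutely_continuous_on ::
  "real set \<Rightarrow> (real \<Rightarrow> 'a::real_normed_vector) \<Rightarrow> bool" where
  "absolutely_continuous_on S f \<longleftrightarrow>
     (\<forall>\<epsilon>>0. \<exists>\<delta>>0. \<forall>D. D division_of (\<Union>D) \<longrightarrow> \<Union>D \<subseteq> S \<longrightarrow>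
        (\<Sum>K\<in>D. Sup K - Inf K) < \<delta> \<longrightarrow>
        (\<Sum>K\<in>D. norm (f (Sup K) - f (Inf K))) < \<epsilon>)"

definition tangent_cone :: "'a::real_normed_vector set \<Rightarrow> 'a \<Rightarrow> 'a set" where
  "tangent_cone D x =
     {d. x \<in> D \<and>
         (\<exists>(X :: nat \<Rightarrow> 'a) (s :: nat \<Rightarrow> real).
            (\<forall>i. X i \<in> D) \<and> (\<forall>i. s i > 0) \<and> X \<longlonglongrightarrow> x \<and> s \<longlonglongrightarrow> 0 \<and>
            (\<lambda>i. (X i - x) /\<^sub>R s i) \<longlonglongrightarrow> d)}"

definition normal_cone :: "'a::real_inner set \<Rightarrow> 'a \<Rightarrow> 'a set" where
  "normal_cone D x = {v. x \<in> D \<and> (\<forall>d\<in>tangent_cone D x. v \<bullet> d \<le> 0)}"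

(* The arg min is kept as the set of all minimisers, since it need not be a singleton
   for a cone K that is not convex. *)
definition ext_proj :: "'a::real_inner set \<Rightarrow> 'a set \<Rightarrow> 'a \<Rightarrow> 'a set" where
  "ext_proj K F v =
     {w. is_arg_min (\<lambda>w. 1 / 2 * (norm (w - v))\<^sup>2) (\<lambda>w. w \<in> K \<and> w - v \<in> F) w}"

definition uniformly_prox_regular ::
  "real \<Rightarrow> (real \<Rightarrow> 'a::real_inner set) \<Rightarrow> bool" where
  "uniformly_prox_regular T C \<longleftrightarrow>
     (\<exists>r>0. \<forall>t\<in>{0..T}. \<forall>x\<in>C t. \<forall>x'\<in>C t. \<forall>\<zeta>\<in>normal_cone (C t) x.
        \<zeta> \<bullet> (x' - x) \<le> norm \<zeta> / (2 * r) * (norm (x' - x))\<^sup>2)"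

(* On the compact interval [0,T] every finite Borel measure is Radon.
   Note infdist z {} = 0; this is harmless where C is the moving set of a sweeping process,
   since a solution x has x t in C t, so no C t with t in [0,T] is empty. *)
definition of_bounded_variation ::
  "real \<Rightarrow> (real \<Rightarrow> 'a::metric_space set) \<Rightarrow> bool" where
  "of_bounded_variation T C \<longleftrightarrow>
     (\<exists>\<mu> :: real measure. finite_measure \<mu> \<and> sets \<mu> = sets (restrict_space borel {0..T}) \<and>
        (\<forall>z s t. 0 \<le> s \<longrightarrow> s \<le> t \<longrightarrow> t \<le> T \<longrightarrow>
           \<bar>infdist z (C t) - infdist z (C s)\<bar> \<le> measure \<mu> {s<..t}))"

definition forward_lipschitz ::
  "real \<Rightarrow> (real \<Rightarrow> 'a::real_normed_vector set) \<Rightarrow> bool" where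
  "forward_lipschitz T C \<longleftrightarrow>
     (\<exists>L\<ge>0. \<forall>s t. 0 \<le> s \<longrightarrow> s \<le> t \<longrightarrow> t \<le> T \<longrightarrow>
        (\<forall>x\<in>C s. \<exists>x'\<in>C t. norm (x' - x) \<le> L * (t - s)))"

(* The order on real^'k is componentwise. *)
definition moving_set :: "(real^'n \<Rightarrow> real \<Rightarrow> real^'k) \<Rightarrow> real \<Rightarrow> (real^'n) set" where
  "moving_set c t = {x. c x t \<ge> 0}"

definition normals_by_gradients :: "real \<Rightarrow> (real^'n \<Rightarrow> real \<Rightarrow> real^'k) \<Rightarrow> bool" where
  "normals_by_gradients T c \<longleftrightarrow>
     (\<forall>t\<in>{0..T}. \<forall>x\<in>moving_set c t.
        normal_cone (moving_set c t) x =
          {- (\<Sum>i\<in>{i. c x t $ i = 0}. l i *\<^sub>R gradient (\<lambda>z. c z t $ i) x) | l. \<forall>i. l i \<ge> 0})"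

(* R^(n+1) is represented by the product (real^'n) * real, whose inner product and norm are
   the Euclidean ones. *)
definition c_hat :: "(real^'n \<Rightarrow> real \<Rightarrow> real^'k) \<Rightarrow> (real^'n) \<times> real \<Rightarrow> real^'k" where
  "c_hat c y = c (fst y) (snd y)"

definition extended_set :: "(real^'n \<Rightarrow> real \<Rightarrow> real^'k) \<Rightarrow> ((real^'n) \<times> real) set" where
  "extended_set c = {y. c_hat c y \<ge> 0}"

(* The matrix E = (e_1, ..., e_n) as a linear map; its transpose is the adjoint. *)
definition E_map :: "real^'n \<Rightarrow> (real^'n) \<times> real" where
  "E_map z = (\<Sum>i\<in>UNIV. z $ i *\<^sub>R (axis i 1, 0))"

definition E_space :: "((real^'n) \<times> real) set" where
  "E_space = {E_map (adjoint E_map z) | z. True}"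

definition sweeping_solution ::
  "real \<Rightarrow> ((real^'n) \<times> (real^'m) \<Rightarrow> real^'n) \<Rightarrow> (real \<Rightarrow> real^'m) \<Rightarrow>
     (real \<Rightarrow> (real^'n) set) \<Rightarrow> (real \<Rightarrow> real^'n) \<Rightarrow> bool" where
  "sweeping_solution T f u C x \<longleftrightarrow>
     absolutely_continuous_on {0..T} x \<and>
     (\<forall>t\<in>{0..T}. x t \<in> C t) \<and>
     x 0 \<in> C 0 \<and>
     (AE t in lborel. t \<in> {0..T} \<longrightarrow>
        (\<exists>v. (x has_vector_derivative v) (at t within {0..T}) \<and>
             v \<in> {f (x t, u t) - \<zeta> | \<zeta>. \<zeta> \<in> normal_cone (C t) (x t)}))"

(* The differential equation is read as an equation: the arg min is the single vector y'(t). *)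
definition epds_solution ::
  "real \<Rightarrow> ((real^'n) \<times> (real^'m) \<Rightarrow> real^'n) \<Rightarrow> (real \<Rightarrow> real^'m) \<Rightarrow>
     ((real^'n) \<times> real) set \<Rightarrow> real^'n \<Rightarrow> (real \<Rightarrow> (real^'n) \<times> real) \<Rightarrow> bool" where
  "epds_solution T f u D x0 y \<longleftrightarrow>
     absolutely_continuous_on {0..T} y \<and>
     (\<forall>t\<in>{0..T}. y t \<in> D) \<and>
     y 0 = (x0, 0) \<and> y 0 \<in> D \<and>
     (AE t in lborel. t \<in> {0..T} \<longrightarrow>
        (\<exists>v. (y has_vector_derivative v) (at t within {0..T}) \<and>
             ext_proj (tangent_cone D (y t)) E_space (f (fst (y t), u t), 1) = {v}))"

end

theory Submission
  imports Defs
begin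

text \<open>
  In the extended projection the last component of the velocity is prescribed to be 1, since
  \<open>w - (f, 1) \<in> E_space\<close> leaves only the first component free.  Hence a solution of the extended system
  has \<open>\<tau>' = 1\<close> almost everywhere, and absolute continuity gives \<open>\<tau> t = t\<close>
  (\<open>absolutely_continuous_on_unit_speed\<close>).  What remains is to show, for almost every \<open>t\<close> at which
  \<open>x\<close> has a derivative \<open>v\<close>, that \<open>f - v\<close> is normal to \<open>C(t)\<close> at \<open>x t\<close> if and only if \<open>v\<close> is the unique point
  closest to \<open>f\<close> among the \<open>w\<close> such that \<open>(w, 1)\<close> is tangent to the graph of the moving set at
  \<open>(x t, t)\<close>.

  The two cones live in different spaces.  The sets at different times are linked by forward Lipschitz
  continuity, and the cones by a fact from measure theory: if \<open>K t\<close> is any family of subsets of a second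
  countable metric space, with no measurability assumed, then for almost every \<open>t\<close> and every
  \<open>\<delta> > 0\<close> each \<open>p \<in> K t\<close> is approximated by points of \<open>K t'\<close> at times \<open>t'\<close> so close together that every
  interval \<open>[t + h, t + (1 + \<delta>) h]\<close> with small \<open>h > 0\<close> contains one (\<open>AE_right_recurrent\<close>).  The reason
  is that for each set \<open>A\<close> of reals the points of \<open>A\<close> that have, arbitrarily close to their right, gaps
  of \<open>A\<close> of length proportional to the distance form a null set (\<open>negligible_right_porous\<close>); this is
  applied to \<open>A = {t. K t \<inter> B \<noteq> {}}\<close> for \<open>B\<close> in a countable base.

  \<^emph>\<open>From the sweeping process to the projection.\<close>  Let \<open>\<zeta> = f - v\<close> be normal and \<open>(w, 1)\<close> tangent to the
  graph, witnessed by points \<open>a \<in> C(b)\<close> with \<open>b > t\<close>.  Choose \<open>t'\<close> slightly after \<open>b\<close> with a normal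
  \<open>\<zeta>'\<close> of \<open>C(t')\<close> at \<open>x t'\<close> near \<open>\<zeta>\<close>, and move \<open>a\<close> into \<open>C(t')\<close> by forward Lipschitz continuity.
  Prox-regularity at time \<open>t'\<close> and a limit yield \<open>\<zeta> \<bullet> (w - v) \<le> 0\<close> (\<open>normal_velocity_inequality\<close>),
  so \<open>v\<close>, which is itself feasible, is the unique closest point (\<open>ext_proj_E_space_eq\<close>).

  \<^emph>\<open>From the projection to the sweeping process.\<close>  A tangent vector \<open>d\<close> of a closed prox-regular set is
  derivable, that is, it is approximated at \<^emph>\<open>all\<close> small step sizes rather than along a sequence
  (\<open>prox_regular_tangent_derivable\<close>).  This property, with a uniform range of step sizes, recurs at
  times \<open>t'\<close> decreasing to \<open>t\<close>, so steps of length \<open>t' - t\<close> show that \<open>(v + \<rho> d, 1)\<close> is tangent to the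
  graph for every \<open>\<rho> > 0\<close> (\<open>velocity_plus_tangent\<close>).  Minimality of \<open>v\<close> then gives
  \<open>(f - v) \<bullet> d \<le> 0\<close>.
\<close>

section \<open>Right porosity and recurrence at almost every time\<close>

text \<open>
  By the Vitali covering theorem, the porous points are covered up to a null set by disjoint intervals
  inside an open set \<open>U\<close> that barely exceeds the closure \<open>F\<close> of \<open>A\<close>.  A fixed proportion of each
  interval lies in \<open>U - F\<close>, so the total length of the intervals is small.
\<close>

lemma negligible_uniformly_right_porous:
  fixes A :: "real set"
  assumes bdd: "bounded A" and \<delta>: "\<delta> > 0"
  shows "negligible {t\<in>A. \<forall>\<eta>>0. \<exists>h>0. h < \<eta> \<and> A \<inter> {t + h..t + (1 + \<delta>) * h} = {}}"
    (is "negligible ?N")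
  unfolding negligible_outer_le
proof (intro allI impI)
  fix e :: real
  assume e: "e > 0"
  define F where "F = closure A"
  define \<epsilon> where "\<epsilon> = e * \<delta> / (1 + \<delta>)"
  have \<epsilon>: "\<epsilon> > 0"
    using e \<delta> by (simp add: \<epsilon>_def)
  have "compact F"
    using bdd by (simp add: F_def compact_closure)
  then have F_meas: "F \<in> lmeasurable"
    by (rule lmeasurable_compact)
  then obtain U where U: "open U" "F \<subseteq> U" "U - F \<in> lmeasurable" "emeasure lebesgue (U - F) < ennreal \<epsilon>"
    using sets_lebesgue_outer_open[of F \<epsilon>] \<epsilon> by (auto simp: fmeasurableD)
  then have UF: "measure lebesgue (U - F) < \<epsilon>"
    by (metis \<epsilon> emeasure_eq_measure2 ennreal_less_iff measure_nonneg)
  \<comment> \<open>A pair \<open>(t, h)\<close> stands for the interval \<open>[t, t + (1 + \<delta>) h]\<close>, all of which except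
      \<open>[t, t + h)\<close> misses \<open>A\<close>.\<close>
  define K where "K = {(t, h). h > 0 \<and> A \<inter> {t + h..t + (1 + \<delta>) * h} = {} \<and> {t..t + (1 + \<delta>) * h} \<subseteq> U}"
  define a where "a = (\<lambda>(t, h). t + (1 + \<delta>) * h / 2)"
  define r where "r = (\<lambda>(t::real, h). (1 + \<delta>) * h / 2)"
  define gap where "gap = (\<lambda>(t, h). {t + h<..<t + (1 + \<delta>) * h})"
  have ball_eq: "cball (a p) (r p) = {fst p..fst p + (1 + \<delta>) * snd p}" for p
    by (cases p) (simp add: a_def r_def cball_eq_atLeastAtMost)
  have gap_sub: "gap p \<subseteq> cball (a p) (r p)" if "p \<in> K" for p
    using that unfolding ball_eq by (auto simp: gap_def K_def)
  have gap_UF: "gap p \<subseteq> U - F" if "p \<in> K" for p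
  proof -
    have "gap p \<inter> A = {}"
      using that by (fastforce simp: gap_def K_def)
    then have "gap p \<inter> F = {}"
      unfolding F_def by (subst open_Int_closure_eq_empty) (auto simp: gap_def split: prod.splits)
    then show ?thesis
      using that by (fastforce simp: gap_def K_def)
  qed
  have gap_meas: "gap p \<in> lmeasurable" for p
    by (cases p) (simp add: gap_def)
  have ball_gap: "measure lebesgue (cball (a p) (r p)) = (1 + \<delta>) / \<delta> * measure lebesgue (gap p)"
    if "p \<in> K" for p
    using that \<delta> by (cases p) (auto simp: ball_eq gap_def K_def field_simps)
  have r_pos: "0 < r p" if "p \<in> K" for p
    using that \<delta> by (cases p) (auto simp: r_def K_def)
  have fine: "\<exists>p. p \<in> K \<and> t \<in> cball (a p) (r p) \<and> r p < d" if "t \<in> ?N" "d > 0" for t d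
  proof -
    have "t \<in> U"
      using that(1) U(2) closure_subset by (auto simp: F_def)
    then obtain d' where d': "d' > 0" "cball t d' \<subseteq> U"
      using U(1) open_contains_cball by blast
    define \<eta> where "\<eta> = min d d' / (1 + \<delta>)"
    have "\<eta> > 0"
      using d' \<open>d > 0\<close> \<delta> by (simp add: \<eta>_def)
    moreover have "\<forall>\<eta>>0. \<exists>h>0. h < \<eta> \<and> A \<inter> {t + h..t + (1 + \<delta>) * h} = {}"
      using that(1) unfolding mem_Collect_eq by (rule conjunct2)
    ultimately obtain h where h: "h > 0" "h < \<eta>" "A \<inter> {t + h..t + (1 + \<delta>) * h} = {}"
      by (meson)
    have h': "(1 + \<delta>) * h < min d d'"
      using h(2) \<delta> by (simp add: \<eta>_def field_simps)
    have "{t..t + (1 + \<delta>) * h} \<subseteq> cball t d'"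
      using h' by (auto simp: dist_real_def)
    then have "(t, h) \<in> K"
      using h d' by (auto simp: K_def)
    moreover have "t \<in> cball (a (t, h)) (r (t, h))"
      unfolding ball_eq using h(1) \<delta> by simp
    moreover have "r (t, h) < d"
    proof -
      have "(1 + \<delta>) * h > 0"
        using h(1) \<delta> by simp
      then show ?thesis
        using h' \<open>d > 0\<close> unfolding r_def split by linarith
    qed
    ultimately show ?thesis
      by blast
  qed
  obtain C where C: "countable C" "C \<subseteq> K"
      "pairwise (\<lambda>i j. disjnt (cball (a i) (r i)) (cball (a j) (r j))) C"
      "negligible (?N - (\<Union>i\<in>C. cball (a i) (r i)))"
    using Vitali_covering_theorem_cballs[where K=K and a=a and r=r and S="?N", OF r_pos fine] by blast
  have le: "measure lebesgue (\<Union>i\<in>D. cball (a i) (r i)) \<le> e" if D: "D \<subseteq> C" "finite D" for D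
  proof -
    have DK: "p \<in> K" if "p \<in> D" for p
      using that D C(2) by blast
    have "measure lebesgue (\<Union>i\<in>D. cball (a i) (r i)) \<le> (\<Sum>i\<in>D. measure lebesgue (cball (a i) (r i)))"
      using D by (intro measure_UNION_le) auto
    also have "\<dots> = (1 + \<delta>) / \<delta> * (\<Sum>i\<in>D. measure lebesgue (gap i))"
      unfolding sum_distrib_left by (intro sum.cong refl ball_gap DK)
    also have "(\<Sum>i\<in>D. measure lebesgue (gap i)) = measure lebesgue (\<Union>i\<in>D. gap i)"
    proof (rule measure_UNION'[symmetric])
      show "pairwise (\<lambda>i j. disjnt (gap i) (gap j)) D"
        using C(3) D(1) DK gap_sub unfolding pairwise_def disjnt_def by (smt (verit) disjoint_iff subset_iff)
    qed (use D gap_meas in auto)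
    also have "\<dots> \<le> measure lebesgue (U - F)"
    proof (rule measure_mono_fmeasurable)
      show "(\<Union>i\<in>D. gap i) \<subseteq> U - F"
        using DK gap_UF by blast
      show "(\<Union>i\<in>D. gap i) \<in> sets lebesgue"
        using D gap_meas by (intro sets.finite_UN) (auto simp: fmeasurableD)
    qed (rule U(3))
    finally have "measure lebesgue (\<Union>i\<in>D. cball (a i) (r i)) \<le> (1 + \<delta>) / \<delta> * \<epsilon>"
      using UF \<delta> by (smt (verit) divide_pos_pos mult_left_mono)
    then show ?thesis
      using \<delta> by (simp add: \<epsilon>_def)
  qed
  let ?V = "\<Union>i\<in>C. cball (a i) (r i)"
  have V: "?V \<in> lmeasurable" "measure lebesgue ?V \<le> e"
    using fmeasurable_UN_bound[OF C(1) _ le] measure_UN_bound[OF C(1) _ le] by auto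
  show "\<exists>T. ?N \<subseteq> T \<and> T \<in> lmeasurable \<and> measure lebesgue T \<le> e"
  proof (intro exI conjI)
    show "?N \<subseteq> ?V \<union> (?N - ?V)"
      by blast
    show "?V \<union> (?N - ?V) \<in> lmeasurable"
      by (rule fmeasurable.Un[OF V(1) negligible_imp_measurable[OF C(4)]])
    have "measure lebesgue (?V \<union> (?N - ?V)) = measure lebesgue ?V"
      by (rule measure_Un_null_set) (use V C(4) in \<open>auto simp: fmeasurableD negligible_iff_null_sets\<close>)
    then show "measure lebesgue (?V \<union> (?N - ?V)) \<le> e"
      using V(2) by (simp only:)
  qed
qed

text \<open>
  The set \<open>A\<close> need not be measurable.
\<close>

lemma negligible_right_porous:
  fixes A :: "real set"
  shows "negligible {t\<in>A. \<exists>\<delta>>0. \<forall>\<eta>>0. \<exists>h>0. h < \<eta> \<and> A \<inter> {t + h..t + (1 + \<delta>) * h} = {}}"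
    (is "negligible ?N")
proof -
  define B where "B n = A \<inter> {- real n..real n}" for n
  define P where "P n m = {t\<in>B n. \<forall>\<eta>>0. \<exists>h>0. h < \<eta> \<and> B n \<inter> {t + h..t + (1 + 1 / Suc m) * h} = {}}" for n m
  have "?N \<subseteq> (\<Union>n. \<Union>m. P n m)"
  proof
    fix t assume "t \<in> ?N"
    then obtain \<delta> where t: "t \<in> A" and \<delta>: "\<delta> > 0"
      and gaps: "\<And>\<eta>. \<eta> > 0 \<Longrightarrow> \<exists>h>0. h < \<eta> \<and> A \<inter> {t + h..t + (1 + \<delta>) * h} = {}"
      by blast
    obtain n where n: "\<bar>t\<bar> \<le> real n"
      using real_arch_simple by blast
    obtain m where m: "1 / real (Suc m) < \<delta>"
      using \<delta> by (metis inverse_eq_divide reals_Archimedean)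
    have "\<exists>h>0. h < \<eta> \<and> B n \<inter> {t + h..t + (1 + 1 / Suc m) * h} = {}" if "\<eta> > 0" for \<eta>
    proof -
      obtain h where h: "h > 0" "h < \<eta>" "A \<inter> {t + h..t + (1 + \<delta>) * h} = {}"
        using gaps[OF \<open>\<eta> > 0\<close>] by blast
      have "(1 + 1 / Suc m) * h \<le> (1 + \<delta>) * h"
        using m h(1) by (intro mult_right_mono) auto
      then have "B n \<inter> {t + h..t + (1 + 1 / Suc m) * h} \<subseteq> A \<inter> {t + h..t + (1 + \<delta>) * h}"
        by (auto simp: B_def)
      then show ?thesis
        using h by blast
    qed
    then have "t \<in> P n m"
      using t n by (auto simp: P_def B_def)
    then show "t \<in> (\<Union>n. \<Union>m. P n m)"
      by blast
  qed
  moreover have "negligible (P n m)" for n m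
    unfolding P_def by (rule negligible_uniformly_right_porous) (auto simp: B_def bounded_Int)
  then have "negligible (\<Union>n. \<Union>m. P n m)"
    by (intro negligible_countable_Union) (auto intro!: negligible_countable_Union)
  ultimately show ?thesis
    by (rule negligible_subset[rotated])
qed

lemma AE_right_density:
  fixes A :: "'i \<Rightarrow> real set"
  assumes "countable I"
  shows "AE t in lborel. \<forall>i\<in>I. t \<in> A i \<longrightarrow>
           (\<forall>\<delta>>0. \<exists>\<eta>>0. \<forall>h. 0 < h \<longrightarrow> h < \<eta> \<longrightarrow> A i \<inter> {t + h..t + (1 + \<delta>) * h} \<noteq> {})"
proof -
  define P where "P i = {t\<in>A i. \<exists>\<delta>>0. \<forall>\<eta>>0. \<exists>h>0. h < \<eta> \<and> A i \<inter> {t + h..t + (1 + \<delta>) * h} = {}}" for i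
  have "negligible (\<Union>i\<in>I. P i)"
    unfolding P_def using assms by (intro negligible_countable_Union) (auto intro: negligible_right_porous)
  then have "AE t in lebesgue. t \<notin> (\<Union>i\<in>I. P i)"
    by (intro AE_not_in) (simp add: negligible_iff_null_sets)
  then have "AE t in lborel. t \<notin> (\<Union>i\<in>I. P i)"
    by (simp only: AE_completion_iff)
  then show ?thesis
  proof (rule AE_mp, intro AE_I2 impI ballI allI)
    fix t i \<delta> assume *: "t \<notin> (\<Union>i\<in>I. P i)" "i \<in> I" "t \<in> A i" "(0::real) < \<delta>"
    then have "t \<notin> P i"
      by blast
    then have "\<not> (\<forall>\<eta>>0. \<exists>h>0. h < \<eta> \<and> A i \<inter> {t + h..t + (1 + \<delta>) * h} = {})"
      using *(3,4) unfolding P_def by simp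
    then show "\<exists>\<eta>>0. \<forall>h. 0 < h \<longrightarrow> h < \<eta> \<longrightarrow> A i \<inter> {t + h..t + (1 + \<delta>) * h} \<noteq> {}"
      by meson
  qed
qed

text \<open>
  No measurability of \<open>K\<close> is assumed, because \<open>AE_right_density\<close> holds for arbitrary sets of times.
\<close>

lemma AE_right_recurrent:
  fixes K :: "real \<Rightarrow> 'a::{metric_space, second_countable_topology} set"
  shows "AE t in lborel. \<forall>p\<in>K t. \<forall>\<epsilon>>0. \<forall>\<delta>>0. \<exists>\<eta>>0. \<forall>h. 0 < h \<longrightarrow> h < \<eta> \<longrightarrow>
           (\<exists>t'\<in>{t + h..t + (1 + \<delta>) * h}. \<exists>p'\<in>K t'. dist p' p < \<epsilon>)"
proof -
  obtain B :: "'a set set" where B: "countable B" "topological_basis B"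
    using ex_countable_basis by blast
  from AE_right_density[OF B(1), of "\<lambda>b. {t. K t \<inter> b \<noteq> {}}"]
  show ?thesis
  proof (rule AE_mp, intro AE_I2 impI ballI allI)
    fix t p and \<epsilon> \<delta> :: real
    assume dens: "\<forall>b\<in>B. t \<in> {t. K t \<inter> b \<noteq> {}} \<longrightarrow> (\<forall>\<delta>>0. \<exists>\<eta>>0. \<forall>h. 0 < h \<longrightarrow> h < \<eta> \<longrightarrow>
        {t. K t \<inter> b \<noteq> {}} \<inter> {t + h..t + (1 + \<delta>) * h} \<noteq> {})"
      and p: "p \<in> K t" and \<epsilon>: "0 < \<epsilon>" and \<delta>: "0 < \<delta>"
    obtain b where b: "b \<in> B" "p \<in> b" "b \<subseteq> ball p \<epsilon>"
      using topological_basisE[OF B(2), of "ball p \<epsilon>" p] \<epsilon> by auto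
    obtain \<eta> where \<eta>: "\<eta> > 0" and
      meet: "\<forall>h. 0 < h \<longrightarrow> h < \<eta> \<longrightarrow> {t. K t \<inter> b \<noteq> {}} \<inter> {t + h..t + (1 + \<delta>) * h} \<noteq> {}"
      using dens b(1,2) p \<delta> by blast
    show "\<exists>\<eta>>0. \<forall>h. 0 < h \<longrightarrow> h < \<eta> \<longrightarrow>
           (\<exists>t'\<in>{t + h..t + (1 + \<delta>) * h}. \<exists>p'\<in>K t'. dist p' p < \<epsilon>)"
    proof (intro exI conjI allI impI)
      fix h assume h: "0 < h" "h < \<eta>"
      then obtain t' p' where "t' \<in> {t + h..t + (1 + \<delta>) * h}" "p' \<in> K t'" "p' \<in> b"
        using meet by blast
      then show "\<exists>t'\<in>{t + h..t + (1 + \<delta>) * h}. \<exists>p'\<in>K t'. dist p' p < \<epsilon>"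
        using b(3) by (meson mem_ball dist_commute_lessI subsetD)
    qed (rule \<eta>)
  qed
qed

text \<open>
  If \<open>d\<close> is a derivable direction of \<open>C t\<close> at \<open>x t\<close>, then approximants of \<open>d\<close> are available, over one range
  of step sizes \<open>s < \<eta>\<close>, also at times \<open>t'\<close> arbitrarily close to the right of \<open>t\<close>.
\<close>

lemma AE_derivable_recurrent:
  fixes C :: "real \<Rightarrow> 'a::{real_normed_vector, second_countable_topology} set" and x :: "real \<Rightarrow> 'a"
  shows "AE t in lborel. \<forall>d.
    (\<forall>\<epsilon>>0. \<exists>\<eta>>0. \<forall>s. 0 < s \<longrightarrow> s < \<eta> \<longrightarrow> (\<exists>b\<in>ball d \<epsilon>. x t + s *\<^sub>R b \<in> C t)) \<longrightarrow>
    (\<forall>\<epsilon>>0. \<exists>\<eta>>0. \<forall>\<kappa>>0. \<exists>t'. t < t' \<and> t' < t + \<kappa> \<and>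
      (\<forall>s. 0 < s \<longrightarrow> s < \<eta> \<longrightarrow> (\<exists>b\<in>ball d \<epsilon>. x t' + s *\<^sub>R b \<in> C t')))"
proof -
  obtain B :: "'a set set" where B: "countable B" "topological_basis B"
    using ex_countable_basis by blast
  define A where "A = (\<lambda>(V, m::nat). {t. \<forall>s. 0 < s \<longrightarrow> s < 1 / Suc m \<longrightarrow> (\<exists>b\<in>V. x t + s *\<^sub>R b \<in> C t)})"
  have A_iff: "t \<in> A (V, m) \<longleftrightarrow> (\<forall>s. 0 < s \<longrightarrow> s < 1 / Suc m \<longrightarrow> (\<exists>b\<in>V. x t + s *\<^sub>R b \<in> C t))" for t V m
    by (simp add: A_def)
  have "countable (B \<times> (UNIV :: nat set))"
    using B(1) by auto
  from AE_right_density[OF this, of A] show ?thesis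
  proof (rule AE_mp, intro AE_I2 impI allI)
    fix t d and \<epsilon> :: real
    assume dens: "\<forall>i\<in>B \<times> UNIV. t \<in> A i \<longrightarrow>
        (\<forall>\<delta>>0. \<exists>\<eta>>0. \<forall>h. 0 < h \<longrightarrow> h < \<eta> \<longrightarrow> A i \<inter> {t + h..t + (1 + \<delta>) * h} \<noteq> {})"
      and deriv: "\<forall>\<epsilon>>0. \<exists>\<eta>>0. \<forall>s. 0 < s \<longrightarrow> s < \<eta> \<longrightarrow> (\<exists>b\<in>ball d \<epsilon>. x t + s *\<^sub>R b \<in> C t)"
      and \<epsilon>: "0 < \<epsilon>"
    obtain V where V: "V \<in> B" "d \<in> V" "V \<subseteq> ball d \<epsilon>"
      using topological_basisE[OF B(2), of "ball d \<epsilon>" d] \<epsilon> by auto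
    have "open V"
      using B(2) V(1) by (rule topological_basis_open)
    then obtain \<epsilon>' where \<epsilon>': "\<epsilon>' > 0" "ball d \<epsilon>' \<subseteq> V"
      using V(2) open_contains_ball by blast
    obtain \<eta> where \<eta>: "\<eta> > 0" "\<forall>s. 0 < s \<longrightarrow> s < \<eta> \<longrightarrow> (\<exists>b\<in>ball d \<epsilon>'. x t + s *\<^sub>R b \<in> C t)"
      using deriv \<epsilon>'(1) by blast
    obtain m where m: "1 / real (Suc m) < \<eta>"
      using \<eta>(1) by (metis inverse_eq_divide reals_Archimedean)
    have "t \<in> A (V, m)"
      unfolding A_iff using \<eta>(2) m \<epsilon>'(2) by (meson less_trans subsetD)
    then have "\<exists>\<eta>>0. \<forall>h. 0 < h \<longrightarrow> h < \<eta> \<longrightarrow> A (V, m) \<inter> {t + h..t + (1 + 1) * h} \<noteq> {}"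
      using dens V(1) zero_less_one by blast
    then obtain \<eta>' where \<eta>': "\<eta>' > 0" "\<And>h. \<lbrakk>0 < h; h < \<eta>'\<rbrakk> \<Longrightarrow> A (V, m) \<inter> {t + h..t + (1 + 1) * h} \<noteq> {}"
      by blast
    show "\<exists>\<eta>>0. \<forall>\<kappa>>0. \<exists>t'. t < t' \<and> t' < t + \<kappa> \<and>
      (\<forall>s. 0 < s \<longrightarrow> s < \<eta> \<longrightarrow> (\<exists>b\<in>ball d \<epsilon>. x t' + s *\<^sub>R b \<in> C t'))"
    proof (rule exI[of _ "1 / real (Suc m)"], intro conjI allI impI)
      fix \<kappa> :: real assume "0 < \<kappa>"
      define h where "h = min \<eta>' \<kappa> / 3"
      have h: "0 < h" "h < \<eta>'" "2 * h < \<kappa>"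
        using \<eta>'(1) \<open>0 < \<kappa>\<close> by (auto simp: h_def)
      then obtain t' where t': "t' \<in> A (V, m)" "t' \<in> {t + h..t + (1 + 1) * h}"
        using \<eta>'(2) by blast
      have "t < t'" "t' < t + \<kappa>"
        using t'(2) h by auto
      moreover have "\<forall>s. 0 < s \<longrightarrow> s < 1 / real (Suc m) \<longrightarrow> (\<exists>b\<in>ball d \<epsilon>. x t' + s *\<^sub>R b \<in> C t')"
        using t'(1) V(3) unfolding A_iff by (meson subsetD)
      ultimately show "\<exists>t'. t < t' \<and> t' < t + \<kappa> \<and>
        (\<forall>s. 0 < s \<longrightarrow> s < 1 / real (Suc m) \<longrightarrow> (\<exists>b\<in>ball d \<epsilon>. x t' + s *\<^sub>R b \<in> C t'))"
        by blast
    qed simp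
  qed
qed

section \<open>Absolutely continuous functions\<close>

lemma tagged_division_interval_real:
  fixes a b :: real
  assumes "p tagged_division_of {a..b}" "(x, K) \<in> p"
  shows "\<exists>l u. K = {l..u} \<and> l \<le> u \<and> x \<in> {l..u} \<and> {l..u} \<subseteq> {a..b}"
proof -
  have K: "x \<in> K" "K \<subseteq> {a..b}" "\<exists>l u. K = cbox l u"
    using tagged_division_ofD(2-4)[OF assms] by auto
  then obtain l u where "K = {l..u}"
    by auto
  with K(1,2) show ?thesis
    by auto
qed

lemma absolutely_continuous_on_zero_derivative_increment:
  fixes g :: "real \<Rightarrow> 'a::real_normed_vector"
  assumes ac: "absolutely_continuous_on {a..b} g" and "a \<le> b"
    and N: "negligible N"
    and deriv: "\<And>t. t \<in> {a..b} - N \<Longrightarrow> (g has_vector_derivative 0) (at t within {a..b})"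
  shows "g b = g a"
proof -
  have small: "norm (g b - g a) \<le> e * (b - a) + e" if e: "e > 0" for e
  proof -
    obtain d where d: "d > 0" and ac_d: "\<forall>D. D division_of (\<Union>D) \<longrightarrow> \<Union>D \<subseteq> {a..b} \<longrightarrow>
        (\<Sum>K\<in>D. Sup K - Inf K) < d \<longrightarrow> (\<Sum>K\<in>D. norm (g (Sup K) - g (Inf K))) < e"
      using ac[unfolded absolutely_continuous_on_def, rule_format, OF e] by (elim exE conjE)
    have "N \<in> sets lebesgue"
      using N by (simp add: negligible_imp_sets)
    then obtain U where U: "open U" "N \<subseteq> U" "U - N \<in> lmeasurable" "emeasure lebesgue (U - N) < ennreal d"
      using sets_lebesgue_outer_open[of N d] d by auto
    have UN: "U = N \<union> (U - N)"
      using U(2) by blast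
    have U_meas: "U \<in> lmeasurable"
      using U(3) N negligible_imp_measurable by (subst UN) blast
    have "measure lebesgue (U - N) < d"
      using U(3,4) d by (metis emeasure_eq_measure2 ennreal_less_iff measure_nonneg)
    then have U_small: "measure lebesgue U < d"
      using N U_meas by (simp add: measure_Diff_null_set negligible_iff_null_sets fmeasurableD)
    have "\<exists>r>0. \<forall>s\<in>{a..b}. \<bar>s - t\<bar> < r \<longrightarrow> norm (g s - g t) \<le> e * \<bar>s - t\<bar>" if "t \<in> {a..b} - N" for t
    proof -
      have "(g has_derivative (\<lambda>h. h *\<^sub>R 0)) (at t within {a..b})"
        using deriv[OF that] by (simp add: has_vector_derivative_def)
      then show ?thesis
        using e by (auto simp: has_derivative_within_alt)
    qed
    then obtain r where r: "\<And>t. t \<in> {a..b} - N \<Longrightarrow> r t > 0"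
      "\<And>t s. \<lbrakk>t \<in> {a..b} - N; s \<in> {a..b}; \<bar>s - t\<bar> < r t\<rbrakk> \<Longrightarrow> norm (g s - g t) \<le> e * \<bar>s - t\<bar>"
      by metis
    \<comment> \<open>Intervals tagged outside \<open>N\<close> are short enough for the derivative to bound the increment;
        those tagged in \<open>N\<close> lie in \<open>U\<close>, so their total length is below \<open>d\<close>.\<close>
    define \<gamma> where "\<gamma> t = (if t \<in> N then U else if t \<in> {a..b} then ball t (r t) else UNIV)" for t
    have "gauge \<gamma>"
      using U(1,2) r(1) by (auto simp: gauge_def \<gamma>_def)
    then obtain p where p: "p tagged_division_of {a..b}" "\<gamma> fine p"
      using fine_division_exists_real by blast
    have fin: "finite p"
      using p(1) by (rule tagged_division_of_finite)
    have div: "snd ` p division_of {a..b}"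
      using p(1) by (rule division_of_tagged_division)
    let ?inc = "\<lambda>K. g (Sup K) - g (Inf K)"
    have "g b - g a = (\<Sum>(x, K)\<in>p. ?inc K)"
      using additive_tagged_division_1[OF \<open>a \<le> b\<close> p(1), of g] by simp
    define P where "P = {q\<in>p. fst q \<in> N}"
    have split: "p = P \<union> (p - P)" "P \<inter> (p - P) = {}"
      by (auto simp: P_def)
    have len: "(\<Sum>(x, K)\<in>p. Sup K - Inf K) = b - a"
      using additive_tagged_division_1[OF \<open>a \<le> b\<close> p(1), of "\<lambda>x. x"] by simp
    have good: "norm (?inc K) \<le> e * (Sup K - Inf K)" if xK: "(x, K) \<in> p - P" for x K
    proof -
      obtain l u where K: "K = {l..u}" "l \<le> u" "x \<in> {l..u}" "{l..u} \<subseteq> {a..b}"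
        using tagged_division_interval_real[OF p(1), of x K] xK by blast
      have x: "x \<in> {a..b} - N"
        using K xK by (auto simp: P_def)
      have "K \<subseteq> ball x (r x)"
        using p(2) xK x by (fastforce simp: fine_def \<gamma>_def)
      moreover have "l \<in> K" "u \<in> K"
        using K by auto
      ultimately have "l \<in> ball x (r x)" "u \<in> ball x (r x)"
        by blast+
      then have "\<bar>l - x\<bar> < r x" "\<bar>u - x\<bar> < r x"
        by (simp_all add: dist_real_def abs_minus_commute)
      then have "norm (g l - g x) \<le> e * (x - l)" "norm (g u - g x) \<le> e * (u - x)"
        using r(2)[OF x, of l] r(2)[OF x, of u] K by auto
      then have "norm (g u - g l) \<le> e * (u - x) + e * (x - l)"
        using norm_triangle_ineq4[of "g u - g x" "g l - g x"] by simp
      then show ?thesis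
        using K by (simp add: algebra_simps)
    qed
    have "(\<Sum>(x, K)\<in>p - P. norm (?inc K)) \<le> (\<Sum>(x, K)\<in>p - P. e * (Sup K - Inf K))"
      using good by (intro sum_mono) auto
    also have "\<dots> \<le> (\<Sum>(x, K)\<in>p. e * (Sup K - Inf K))"
    proof (rule sum_mono2[OF fin])
      show "0 \<le> (case q of (x, K) \<Rightarrow> e * (Sup K - Inf K))" if "q \<in> p - (p - P)" for q
      proof -
        have "q \<in> p" using that by blast
        then obtain l u where "snd q = {l..u}" "l \<le> u"
          using tagged_division_interval_real[OF p(1), of "fst q" "snd q"] by auto
        then show ?thesis
          using e by (cases q) simp
      qed
    qed auto
    also have "\<dots> = e * (b - a)"
      unfolding len[symmetric] by (simp add: sum_distrib_left case_prod_unfold)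
    finally have good_sum: "(\<Sum>(x, K)\<in>p - P. norm (?inc K)) \<le> e * (b - a)" .
    have Psub: "P \<subseteq> p"
      by (auto simp: P_def)
    have partial: "P tagged_partial_division_of {a..b}"
      using p(1) Psub by (meson tagged_division_of_def tagged_partial_division_subset)
    let ?D = "snd ` P"
    have D: "?D division_of \<Union>?D"
      using partial_division_of_tagged_division[OF partial] .
    have D_ab: "\<Union>?D \<subseteq> {a..b}"
      using tagged_division_interval_real[OF p(1)] Psub by fastforce
    have D_U: "\<Union>?D \<subseteq> U"
      using p(2) Psub by (fastforce simp: fine_def \<gamma>_def P_def)
    have lenD: "Sup K - Inf K = measure lebesgue K" if K: "K \<in> ?D" for K
    proof -
      obtain x where "(x, K) \<in> p"
        using K Psub by auto
      then obtain l u where "K = {l..u}" "l \<le> u"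
        using tagged_division_interval_real[OF p(1)] by blast
      then show ?thesis
        by simp
    qed
    have "(\<Sum>K\<in>?D. Sup K - Inf K) = (\<Sum>K\<in>?D. measure lebesgue K)"
      by (intro sum.cong refl lenD)
    also have "\<dots> = measure lebesgue (\<Union>?D)"
      using content_division[OF D] by simp
    also have "\<dots> \<le> measure lebesgue U"
      using D_U U_meas D by (intro measure_mono_fmeasurable) (auto intro: fmeasurableD lmeasurable_division)
    finally have "(\<Sum>K\<in>?D. Sup K - Inf K) < d"
      using U_small by simp
    then have bad0: "(\<Sum>K\<in>?D. norm (?inc K)) < e"
      by (rule ac_d[rule_format, OF D D_ab])
    have bad: "(\<Sum>(x, K)\<in>P. norm (?inc K)) < e"
    proof -
      \<comment> \<open>The value 0 on the empty interval is needed because \<open>Sup {}\<close> and \<open>Inf {}\<close> are unspecified.\<close>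
      let ?inc' = "\<lambda>K. if K = {} then 0 else norm (?inc K)"
      have ne: "K \<noteq> {}" if "(x, K) \<in> P" for x K
        using tagged_division_interval_real[OF p(1)] Psub that by fastforce
      have "(\<Sum>(x, K)\<in>P. norm (?inc K)) = (\<Sum>(x, K)\<in>P. ?inc' K)"
        using ne by (intro sum.cong) auto
      also have "\<dots> = (\<Sum>K\<in>?D. ?inc' K)"
        by (rule sum.over_tagged_division_lemma[OF tagged_partial_division_of_Union_self[OF partial]])
          (auto simp: box_eq_empty cbox_interval)
      also have "\<dots> = (\<Sum>K\<in>?D. norm (?inc K))"
        using ne by (intro sum.cong) auto
      finally have "(\<Sum>(x, K)\<in>P. norm (?inc K)) = (\<Sum>K\<in>?D. norm (?inc K))" .
      then show ?thesis
        using bad0 by simp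
    qed
    have "norm (g b - g a) \<le> (\<Sum>(x, K)\<in>p. norm (?inc K))"
      using \<open>g b - g a = _\<close> by (simp add: case_prod_unfold norm_sum)
    also have "\<dots> = (\<Sum>(x, K)\<in>P. norm (?inc K)) + (\<Sum>(x, K)\<in>p - P. norm (?inc K))"
      using fin split Psub by (subst add.commute) (intro sum.subset_diff)
    finally show ?thesis
      using bad good_sum by linarith
  qed
  have "norm (g b - g a) \<le> 0"
  proof (rule field_le_epsilon)
    fix e :: real
    assume "e > 0"
    then have "norm (g b - g a) \<le> e / (b - a + 1) * (b - a) + e / (b - a + 1)"
      using \<open>a \<le> b\<close> by (intro small) simp
    also have "\<dots> = e / (b - a + 1) * (b - a + 1)"
      by (simp only: distrib_left mult_1_right)
    also have "\<dots> = e"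
      using \<open>a \<le> b\<close> by simp
    finally show "norm (g b - g a) \<le> 0 + e"
      by simp
  qed
  then show ?thesis
    by simp
qed

lemma absolutely_continuous_on_subset:
  assumes "absolutely_continuous_on S f" "T \<subseteq> S"
  shows "absolutely_continuous_on T f"
  unfolding absolutely_continuous_on_def
proof (intro allI impI)
  fix e :: real assume "e > 0"
  obtain d where d: "d > 0" "\<forall>D. D division_of (\<Union>D) \<longrightarrow> \<Union>D \<subseteq> S \<longrightarrow>
      (\<Sum>K\<in>D. Sup K - Inf K) < d \<longrightarrow> (\<Sum>K\<in>D. norm (f (Sup K) - f (Inf K))) < e"
    using assms(1)[unfolded absolutely_continuous_on_def, rule_format, OF \<open>e > 0\<close>] by (elim exE conjE)
  have "(\<Sum>K\<in>D. norm (f (Sup K) - f (Inf K))) < e"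
    if "D division_of (\<Union>D)" "\<Union>D \<subseteq> T" "(\<Sum>K\<in>D. Sup K - Inf K) < d" for D
    using d(2)[rule_format, OF that(1) order_trans[OF that(2) assms(2)] that(3)] .
  then show "\<exists>d>0. \<forall>D. D division_of \<Union> D \<longrightarrow> \<Union> D \<subseteq> T \<longrightarrow>
      (\<Sum>K\<in>D. Sup K - Inf K) < d \<longrightarrow> (\<Sum>K\<in>D. norm (f (Sup K) - f (Inf K))) < e"
    by (intro exI[of _ d] conjI allI impI d(1))
qed

lemma absolutely_continuous_on_dominated:
  assumes g: "absolutely_continuous_on S g"
    and le: "\<And>s t. norm (f t - f s) \<le> norm (g t - g s) + L * \<bar>t - s\<bar>" and L: "L \<ge> 0"
  shows "absolutely_continuous_on S f"
  unfolding absolutely_continuous_on_def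
proof (intro allI impI)
  fix e :: real assume e: "e > 0"
  have "e / 2 > 0"
    using e by simp
  obtain d where d: "d > 0" "\<forall>D. D division_of (\<Union>D) \<longrightarrow> \<Union>D \<subseteq> S \<longrightarrow>
        (\<Sum>K\<in>D. Sup K - Inf K) < d \<longrightarrow> (\<Sum>K\<in>D. norm (g (Sup K) - g (Inf K))) < e / 2"
    using g[unfolded absolutely_continuous_on_def, rule_format, OF \<open>e / 2 > 0\<close>] by (elim exE conjE)
  define d' where "d' = min d (e / 2 / (L + 1))"
  have "d' > 0"
    using d(1) e L by (simp add: d'_def)
  moreover have "(\<Sum>K\<in>D. norm (f (Sup K) - f (Inf K))) < e"
    if D: "D division_of (\<Union>D)" "\<Union>D \<subseteq> S" "(\<Sum>K\<in>D. Sup K - Inf K) < d'" for D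
  proof -
    have nonneg: "Inf K \<le> Sup K" if "K \<in> D" for K
      using division_ofD(3,4)[OF D(1) that] by (metis cInf_le_cSup bdd_below_cbox bdd_above_cbox)
    have "(\<Sum>K\<in>D. norm (f (Sup K) - f (Inf K))) \<le> (\<Sum>K\<in>D. norm (g (Sup K) - g (Inf K)) + L * (Sup K - Inf K))"
      using le nonneg by (intro sum_mono) (metis abs_of_nonneg diff_ge_0_iff_ge)
    also have "\<dots> = (\<Sum>K\<in>D. norm (g (Sup K) - g (Inf K))) + L * (\<Sum>K\<in>D. Sup K - Inf K)"
      by (simp add: sum.distrib sum_distrib_left)
    also have "\<dots> < e / 2 + e / 2"
    proof (rule add_less_le_mono)
      show "(\<Sum>K\<in>D. norm (g (Sup K) - g (Inf K))) < e / 2"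
        using d(2) D by (auto simp: d'_def)
      have "L * (\<Sum>K\<in>D. Sup K - Inf K) \<le> (L + 1) * (e / 2 / (L + 1))"
        using D(3) L nonneg by (intro mult_mono) (auto simp: d'_def intro: sum_nonneg)
      also have "\<dots> = e / 2"
        by (subst times_divide_eq_right) (rule nonzero_mult_div_cancel_left, use L in simp)
      finally show "L * (\<Sum>K\<in>D. Sup K - Inf K) \<le> e / 2" .
    qed
    finally show ?thesis by simp
  qed
  ultimately show "\<exists>d>0. \<forall>D. D division_of \<Union> D \<longrightarrow> \<Union> D \<subseteq> S \<longrightarrow>
      (\<Sum>K\<in>D. Sup K - Inf K) < d \<longrightarrow> (\<Sum>K\<in>D. norm (f (Sup K) - f (Inf K))) < e"
    by blast
qed

lemma absolutely_continuous_on_unit_speed: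
  fixes g :: "real \<Rightarrow> real"
  assumes ac: "absolutely_continuous_on {0..T} g" and "g 0 = 0"
    and deriv: "AE t in lborel. t \<in> {0..T} \<longrightarrow> (g has_vector_derivative 1) (at t within {0..T})"
    and t: "t \<in> {0..T}"
  shows "g t = t"
proof -
  obtain N where N: "N \<in> null_sets lborel" "{t. \<not> (t \<in> {0..T} \<longrightarrow> (g has_vector_derivative 1) (at t within {0..T}))} \<subseteq> N"
    using deriv by (auto elim!: AE_E simp: null_sets_def)
  let ?h = "\<lambda>s. g s - s"
  have "absolutely_continuous_on {0..T} ?h"
    by (rule absolutely_continuous_on_dominated[OF ac, of _ 1]) auto
  then have "absolutely_continuous_on {0..t} ?h"
    by (rule absolutely_continuous_on_subset) (use t in auto)
  then have "?h t = ?h 0"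
  proof (rule absolutely_continuous_on_zero_derivative_increment)
    show "negligible N"
      using N(1) by (simp add: negligible_iff_null_sets null_sets_completionI)
    fix s assume s: "s \<in> {0..t} - N"
    then have "(g has_vector_derivative 1) (at s within {0..T})"
      using N(2) t by auto
    then have "(?h has_vector_derivative 1 - 1) (at s within {0..T})"
      by (rule has_vector_derivative_diff[OF _ has_vector_derivative_id])
    then show "(?h has_vector_derivative 0) (at s within {0..t})"
      using t by (auto intro: has_vector_derivative_within_subset)
  qed (use t in auto)
  then show ?thesis
    using \<open>g 0 = 0\<close> by simp
qed

section \<open>Tangent vectors of prox-regular sets\<close>

lemma nearest_point_normal:
  fixes C :: "'a::real_inner set"
  assumes "p \<in> C" and nearest: "\<And>y. y \<in> C \<Longrightarrow> norm (z - p) \<le> norm (z - y)"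
  shows "z - p \<in> normal_cone C p"
  unfolding normal_cone_def
proof (intro CollectI conjI ballI)
  fix d
  assume "d \<in> tangent_cone C p"
  then obtain X s where X: "\<And>i. X i \<in> C" "\<And>i::nat. s i > 0" "X \<longlonglongrightarrow> p" "s \<longlonglongrightarrow> 0"
    "(\<lambda>i. (X i - p) /\<^sub>R s i) \<longlonglongrightarrow> d"
    unfolding tangent_cone_def by blast
  have le: "(z - p) \<bullet> ((X i - p) /\<^sub>R s i) \<le> norm (X i - p) * norm ((X i - p) /\<^sub>R s i)" for i
  proof -
    have "(norm (z - p))\<^sup>2 \<le> (norm (z - X i))\<^sup>2"
      using nearest[OF X(1)] by (intro power_mono) auto
    also have "z - X i = (z - p) - (X i - p)"
      by simp
    finally have "2 * ((z - p) \<bullet> (X i - p)) \<le> (norm (X i - p))\<^sup>2"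
      unfolding power2_norm_eq_inner inner_diff_left[of "z - p"] inner_diff_right[of _ "z - p"]
      by (simp add: inner_commute)
    then have "(z - p) \<bullet> (X i - p) \<le> (norm (X i - p))\<^sup>2"
      using zero_le_power2[of "norm (X i - p)"] by linarith
    then have "inverse (s i) * ((z - p) \<bullet> (X i - p)) \<le> inverse (s i) * (norm (X i - p))\<^sup>2"
      using X(2)[of i] by (intro mult_left_mono) auto
    then show ?thesis
      using X(2)[of i] by (simp add: power2_eq_square abs_of_pos mult_ac)
  qed
  have "(\<lambda>i. X i - p) \<longlonglongrightarrow> 0"
    using X(3) by (simp add: LIM_zero_iff)
  then have "(\<lambda>i. norm (X i - p) * norm ((X i - p) /\<^sub>R s i)) \<longlonglongrightarrow> 0 * norm d"
    by (intro tendsto_mult tendsto_norm X(5)) (simp add: tendsto_norm_zero)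
  moreover have "(\<lambda>i. (z - p) \<bullet> ((X i - p) /\<^sub>R s i)) \<longlonglongrightarrow> (z - p) \<bullet> d"
    by (intro tendsto_inner tendsto_const X(5))
  ultimately have "(z - p) \<bullet> d \<le> 0 * norm d"
    using le by (intro LIMSEQ_le) auto
  then show "(z - p) \<bullet> d \<le> 0"
    by simp
qed (rule \<open>p \<in> C\<close>)

text \<open>
  A chord of a prox-regular set stays close to the set: the distance is quadratic in the length of
  the chord and linear in the relative position \<open>\<theta>\<close>.
\<close>

lemma prox_regular_segment_near:
  fixes C :: "'a::euclidean_space set"
  assumes "closed C" and r: "r > 0"
    and prox: "\<And>p y \<zeta>. \<lbrakk>p \<in> C; y \<in> C; \<zeta> \<in> normal_cone C p\<rbrakk>
        \<Longrightarrow> \<zeta> \<bullet> (y - p) \<le> norm \<zeta> / (2 * r) * (norm (y - p))\<^sup>2"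
    and xy: "x \<in> C" "y \<in> C" "norm (y - x) \<le> r"
    and \<theta>: "0 \<le> \<theta>" "\<theta> \<le> 1"
  shows "\<exists>p\<in>C. norm (x + \<theta> *\<^sub>R (y - x) - p) \<le> \<theta> * (norm (y - x))\<^sup>2 / r"
proof -
  define z where "z = x + \<theta> *\<^sub>R (y - x)"
  obtain p where p: "p \<in> C" "\<And>q. q \<in> C \<Longrightarrow> dist z p \<le> dist z q"
    using distance_attains_inf[OF \<open>closed C\<close>] xy(1) by (metis empty_iff)
  define n where "n = z - p"
  have "n \<in> normal_cone C p"
    unfolding n_def using p by (intro nearest_point_normal) (auto simp: dist_norm)
  then have x: "n \<bullet> (x - p) \<le> norm n / (2 * r) * (norm (x - p))\<^sup>2"
    and y: "n \<bullet> (y - p) \<le> norm n / (2 * r) * (norm (y - p))\<^sup>2"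
    using prox p xy by auto
  have n_comb: "n = (1 - \<theta>) *\<^sub>R (x - p) + \<theta> *\<^sub>R (y - p)"
    by (simp add: n_def z_def algebra_simps)
  \<comment> \<open>Average the two prox-regularity inequalities at \<open>p\<close> with weights \<open>1 - \<theta>\<close> and \<open>\<theta>\<close>.\<close>
  have "(norm n)\<^sup>2 = (1 - \<theta>) * (n \<bullet> (x - p)) + \<theta> * (n \<bullet> (y - p))"
    unfolding power2_norm_eq_inner by (subst (2) n_comb) (simp add: inner_add_right)
  also have "\<dots> \<le> (1 - \<theta>) * (norm n / (2 * r) * (norm (x - p))\<^sup>2) + \<theta> * (norm n / (2 * r) * (norm (y - p))\<^sup>2)"
    using x y \<theta> by (intro add_mono mult_left_mono) auto
  also have "\<dots> = norm n / (2 * r) * ((1 - \<theta>) * (norm (x - p))\<^sup>2 + \<theta> * (norm (y - p))\<^sup>2)"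
    by (simp only: distrib_left mult_ac)
  also have "(1 - \<theta>) * (norm (x - p))\<^sup>2 + \<theta> * (norm (y - p))\<^sup>2 = (norm n)\<^sup>2 + \<theta> * (1 - \<theta>) * (norm (y - x))\<^sup>2"
  proof -
    define a b where "a = x - p" and "b = y - p"
    have ab: "y - x = b - a" "n = (1 - \<theta>) *\<^sub>R a + \<theta> *\<^sub>R b"
      by (simp_all add: a_def b_def n_comb)
    show ?thesis
      unfolding ab a_def[symmetric] b_def[symmetric] power2_norm_eq_inner
      by (simp add: inner_add_left inner_add_right inner_diff_left inner_diff_right inner_commute algebra_simps)
  qed
  finally have main: "(norm n)\<^sup>2 \<le> norm n / (2 * r) * ((norm n)\<^sup>2 + \<theta> * (1 - \<theta>) * (norm (y - x))\<^sup>2)" .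
  have "norm n \<le> norm (z - x)"
    using p(2)[OF xy(1)] by (simp add: n_def dist_norm)
  also have "\<dots> = \<theta> * norm (y - x)"
    using \<theta> by (simp add: z_def)
  also have "\<dots> \<le> 1 * r"
    using \<theta> xy(3) by (intro mult_mono) auto
  finally have nr: "norm n \<le> r"
    by simp
  have "norm n \<le> \<theta> * (norm (y - x))\<^sup>2 / r"
  proof (cases "n = 0")
    case True
    then show ?thesis using \<theta> r by simp
  next
    case False
    then have "norm n > 0" by simp
    have "norm n * norm n \<le> norm n * (((norm n)\<^sup>2 + \<theta> * (1 - \<theta>) * (norm (y - x))\<^sup>2) / (2 * r))"
      using main by (simp add: power2_eq_square)
    then have "norm n \<le> ((norm n)\<^sup>2 + \<theta> * (1 - \<theta>) * (norm (y - x))\<^sup>2) / (2 * r)"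
      using \<open>norm n > 0\<close> by (rule mult_left_le_imp_le)
    then have "2 * r * norm n \<le> (norm n)\<^sup>2 + \<theta> * (1 - \<theta>) * (norm (y - x))\<^sup>2"
      using r by (simp add: field_simps)
    also have "\<dots> \<le> r * norm n + \<theta> * 1 * (norm (y - x))\<^sup>2"
      unfolding power2_eq_square[of "norm n"] using nr \<theta>
      by (intro add_mono mult_right_mono mult_left_mono) auto
    finally show ?thesis
      using r by (simp add: field_simps)
  qed
  then show ?thesis
    using p(1) unfolding n_def z_def by blast
qed

text \<open>
  One good point \<open>X i\<close> of a sequence that witnesses the tangent vector suffices: by the chord estimate
  the segment from \<open>x\<close> to \<open>X i\<close> provides approximants at all smaller step sizes.
\<close>

lemma prox_regular_tangent_derivable:
  fixes C :: "'a::euclidean_space set"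
  assumes "closed C" and r: "r > 0"
    and prox: "\<And>p y \<zeta>. \<lbrakk>p \<in> C; y \<in> C; \<zeta> \<in> normal_cone C p\<rbrakk>
        \<Longrightarrow> \<zeta> \<bullet> (y - p) \<le> norm \<zeta> / (2 * r) * (norm (y - p))\<^sup>2"
    and d: "d \<in> tangent_cone C x" and \<epsilon>: "\<epsilon> > 0"
  shows "\<exists>\<eta>>0. \<forall>s. 0 < s \<longrightarrow> s < \<eta> \<longrightarrow> (\<exists>b\<in>ball d \<epsilon>. x + s *\<^sub>R b \<in> C)"
proof -
  obtain X s where "x \<in> C" and X: "\<And>i. X i \<in> C" "\<And>i::nat. s i > 0" "X \<longlonglongrightarrow> x" "s \<longlonglongrightarrow> 0"
    "(\<lambda>i. (X i - x) /\<^sub>R s i) \<longlonglongrightarrow> d"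
    using d unfolding tangent_cone_def by blast
  let ?q = "\<lambda>i. (X i - x) /\<^sub>R s i"
  have Xx: "(\<lambda>i. norm (X i - x)) \<longlonglongrightarrow> 0"
    using X(3) by (simp add: LIM_zero_iff tendsto_norm_zero)
  then have "(\<lambda>i. norm (X i - x) * norm (?q i) / r) \<longlonglongrightarrow> 0 * norm d / r"
    using r by (intro tendsto_intros X(5)) auto
  then have "\<forall>\<^sub>F i in sequentially. norm (X i - x) * norm (?q i) / r < \<epsilon> / 2"
    using \<epsilon> by (intro order_tendstoD) auto
  moreover have "\<forall>\<^sub>F i in sequentially. norm (X i - x) < r"
    using Xx r by (rule order_tendstoD)
  moreover have "\<forall>\<^sub>F i in sequentially. dist (?q i) d < \<epsilon> / 2"
    using X(5) \<epsilon> by (intro tendstoD) auto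
  ultimately have "\<forall>\<^sub>F i in sequentially. norm (X i - x) * norm (?q i) / r < \<epsilon> / 2 \<and>
      norm (X i - x) < r \<and> dist (?q i) d < \<epsilon> / 2"
    by eventually_elim simp
  then obtain i where i: "norm (X i - x) * norm (?q i) / r < \<epsilon> / 2" "norm (X i - x) < r" "dist (?q i) d < \<epsilon> / 2"
    by (auto simp: eventually_sequentially)
  show ?thesis
  proof (intro exI conjI allI impI)
    show "s i > 0"
      by (rule X(2))
    fix \<sigma> assume \<sigma>: "0 < \<sigma>" "\<sigma> < s i"
    define \<theta> where "\<theta> = \<sigma> / s i"
    have \<theta>: "0 \<le> \<theta>" "\<theta> \<le> 1"
      using \<sigma> by (auto simp: \<theta>_def)
    obtain p where p: "p \<in> C" "norm (x + \<theta> *\<^sub>R (X i - x) - p) \<le> \<theta> * (norm (X i - x))\<^sup>2 / r"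
      using prox_regular_segment_near[OF \<open>closed C\<close> r prox \<open>x \<in> C\<close> X(1)[of i] _ \<theta>] i(2) by force
    define b where "b = (p - x) /\<^sub>R \<sigma>"
    have "x + \<sigma> *\<^sub>R b \<in> C"
      using p(1) \<sigma> by (simp add: b_def)
    moreover have "dist (?q i) b < \<epsilon> / 2"
    proof -
      have "?q i - b = (x + \<theta> *\<^sub>R (X i - x) - p) /\<^sub>R \<sigma>"
      proof -
        have "inverse \<sigma> * \<theta> = inverse (s i)"
          using \<sigma> by (simp add: \<theta>_def divide_inverse)
        moreover have "x + \<theta> *\<^sub>R (X i - x) - p = \<theta> *\<^sub>R (X i - x) - (p - x)"
          by simp
        ultimately show ?thesis
          by (simp only: b_def scaleR_diff_right[of _ "\<theta> *\<^sub>R (X i - x)"] scaleR_scaleR)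
      qed
      then have "dist (?q i) b = norm (x + \<theta> *\<^sub>R (X i - x) - p) / \<sigma>"
        using \<sigma> by (simp add: dist_norm divide_inverse mult.commute)
      also have "\<dots> \<le> \<theta> * (norm (X i - x))\<^sup>2 / r / \<sigma>"
        using p(2) \<sigma> by (intro divide_right_mono) auto
      also have "\<dots> = norm (X i - x) * norm (?q i) / r"
        using \<sigma> X(2)[of i] by (simp add: \<theta>_def power2_eq_square divide_inverse)
      finally show ?thesis
        using i(1) by linarith
    qed
    then have "b \<in> ball d \<epsilon>"
      using i(3) dist_triangle[of d b "?q i"] by (simp add: dist_commute)
    ultimately show "\<exists>b\<in>ball d \<epsilon>. x + \<sigma> *\<^sub>R b \<in> C"
      by blast
  qed
qed

section \<open>Tangent vectors of the graph of a moving set\<close>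

lemma right_difference_quotients_tendsto:
  assumes deriv: "(f has_vector_derivative v) (at t within S)"
    and s: "\<And>m. s m \<in> S" "\<And>m::nat. t < s m" "s \<longlonglongrightarrow> t"
  shows "(\<lambda>m. (f (s m) - f t) /\<^sub>R (s m - t)) \<longlonglongrightarrow> v"
proof -
  have "((\<lambda>y. (1 / norm (y - t)) *\<^sub>R (f y - (f t + (y - t) *\<^sub>R v))) \<longlongrightarrow> 0) (at t within S)"
    using deriv by (simp add: has_vector_derivative_def has_derivative_within)
  moreover have "filterlim s (at t within S) sequentially"
    using s by (auto simp: filterlim_at intro!: always_eventually)
  ultimately have "(\<lambda>m. (1 / norm (s m - t)) *\<^sub>R (f (s m) - (f t + (s m - t) *\<^sub>R v))) \<longlonglongrightarrow> 0"
    by (rule filterlim_compose)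
  moreover have "(1 / norm (s m - t)) *\<^sub>R (f (s m) - (f t + (s m - t) *\<^sub>R v)) = (f (s m) - f t) /\<^sub>R (s m - t) - v" for m
  proof -
    have "(1 / norm (s m - t)) *\<^sub>R (f (s m) - (f t + (s m - t) *\<^sub>R v))
        = inverse (s m - t) *\<^sub>R ((f (s m) - f t) - (s m - t) *\<^sub>R v)"
      using s(2)[of m] by (simp add: divide_inverse diff_diff_eq)
    also have "\<dots> = (f (s m) - f t) /\<^sub>R (s m - t) - v"
      using s(2)[of m] by (simp only: scaleR_diff_right[of _ "f (s m) - f t"] scaleR_scaleR) simp
    finally show ?thesis .
  qed
  ultimately show ?thesis
    by (simp add: LIM_zero_iff)
qed

lemma normal_velocity_inequality:
  fixes C :: "real \<Rightarrow> 'a::real_inner set" and x :: "real \<Rightarrow> 'a"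
  assumes t: "0 < t" "t < T"
    and x_in: "\<And>s. s \<in> {0..T} \<Longrightarrow> x s \<in> C s"
    and deriv: "(x has_vector_derivative v) (at t within {0..T})"
    and lip: "forward_lipschitz T C" and prox: "uniformly_prox_regular T C"
    and recur: "\<And>\<epsilon> \<delta>. \<lbrakk>\<epsilon> > 0; \<delta> > 0\<rbrakk> \<Longrightarrow> \<exists>\<eta>>0. \<forall>h. 0 < h \<longrightarrow> h < \<eta> \<longrightarrow>
      (\<exists>t'\<in>{t + h..t + (1 + \<delta>) * h}. \<exists>\<zeta>'\<in>normal_cone (C t') (x t'). dist \<zeta>' \<zeta> < \<epsilon>)"
    and w: "(w, 1) \<in> tangent_cone {y. fst y \<in> C (snd y)} (x t, t)"
  shows "\<zeta> \<bullet> (w - v) \<le> 0"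
proof -
  obtain L where L: "L \<ge> 0" "\<And>s t a. \<lbrakk>0 \<le> s; s \<le> t; t \<le> T; a \<in> C s\<rbrakk> \<Longrightarrow> \<exists>a'\<in>C t. norm (a' - a) \<le> L * (t - s)"
    using lip unfolding forward_lipschitz_def by blast
  obtain r where r: "r > 0" "\<And>t p y \<zeta>. \<lbrakk>t \<in> {0..T}; p \<in> C t; y \<in> C t; \<zeta> \<in> normal_cone (C t) p\<rbrakk>
      \<Longrightarrow> \<zeta> \<bullet> (y - p) \<le> norm \<zeta> / (2 * r) * (norm (y - p))\<^sup>2"
    using prox unfolding uniformly_prox_regular_def by blast
  obtain Y s where Y: "\<And>i::nat. Y i \<in> {y. fst y \<in> C (snd y)}" "\<And>i::nat. s i > 0" "Y \<longlonglongrightarrow> (x t, t)" "s \<longlonglongrightarrow> 0"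
    "(\<lambda>i. (Y i - (x t, t)) /\<^sub>R s i) \<longlonglongrightarrow> (w, 1)"
    using w unfolding tangent_cone_def by blast
  define a where "a i = fst (Y i)" for i
  define b where "b i = snd (Y i)" for i
  have ab: "a i \<in> C (b i)" for i
    using Y(1)[of i] by (simp add: a_def b_def)
  have b_lim: "b \<longlonglongrightarrow> t"
    using tendsto_snd[OF Y(3)] by (simp add: b_def[abs_def])
  have qa: "(\<lambda>i. (a i - x t) /\<^sub>R s i) \<longlonglongrightarrow> w"
    using tendsto_fst[OF Y(5)] by (simp add: a_def)
  have qb: "(\<lambda>i. (b i - t) / s i) \<longlonglongrightarrow> 1"
    using tendsto_snd[OF Y(5)] by (simp add: b_def divide_inverse mult.commute)
  have b_gt: "\<forall>\<^sub>F i in sequentially. b i > t"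
  proof -
    have "\<forall>\<^sub>F i in sequentially. (b i - t) / s i > 0"
      using qb by (rule order_tendstoD) simp
    then show ?thesis
      by eventually_elim (use Y(2) in \<open>simp add: zero_less_divide_iff\<close>, metis less_asym)
  qed
  \<comment> \<open>The witness \<open>a i\<close> at time \<open>b i\<close> is carried forward to \<open>x'\<close> at a nearby later time \<open>t'\<close>
      that has a normal \<open>\<zeta>'\<close> close to \<open>\<zeta>\<close>; forward Lipschitz continuity pays for the move.\<close>
  have "\<exists>i t' \<zeta>' x'. i \<ge> m \<and> t < b i \<and> b i \<le> t' \<and> t' \<le> t + (1 + 1 / Suc m) * (b i - t) \<and> t' \<le> T \<and>
      \<zeta>' \<in> normal_cone (C t') (x t') \<and> dist \<zeta>' \<zeta> < 1 / Suc m \<and> x' \<in> C t' \<and> norm (x' - a i) \<le> L * (t' - b i)" for m :: nat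
  proof -
    obtain \<eta> where \<eta>: "\<eta> > 0" and meet: "\<forall>h. 0 < h \<longrightarrow> h < \<eta> \<longrightarrow>
      (\<exists>t'\<in>{t + h..t + (1 + 1 / Suc m) * h}. \<exists>\<zeta>'\<in>normal_cone (C t') (x t'). dist \<zeta>' \<zeta> < 1 / Suc m)"
      using recur[of "1 / Suc m" "1 / Suc m"] by auto
    have "\<forall>\<^sub>F i in sequentially. b i < t + min \<eta> ((T - t) / 2)"
      using b_lim \<eta> t by (intro order_tendstoD) auto
    with b_gt eventually_ge_at_top[of m]
    have "\<forall>\<^sub>F i in sequentially. i \<ge> m \<and> t < b i \<and> b i < t + min \<eta> ((T - t) / 2)"
      by eventually_elim simp
    then obtain i where i: "i \<ge> m" "t < b i" "b i < t + min \<eta> ((T - t) / 2)"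
      by (auto simp: eventually_sequentially)
    have "0 < b i - t" "b i - t < \<eta>"
      using i by auto
    then obtain t' \<zeta>' where t': "t' \<in> {t + (b i - t)..t + (1 + 1 / Suc m) * (b i - t)}"
      "\<zeta>' \<in> normal_cone (C t') (x t')" "dist \<zeta>' \<zeta> < 1 / Suc m"
      using meet by blast
    have "(1 + 1 / Suc m) * (b i - t) \<le> 2 * (b i - t)"
      using i(2) by (intro mult_right_mono) (auto simp: field_simps)
    then have "t' \<le> t + 2 * (b i - t)"
      using t'(1) unfolding atLeastAtMost_iff by (meson add_left_mono order_trans)
    moreover have "b i < t + (T - t) / 2"
      using i(3) by simp
    ultimately have "t' \<le> T"
      by (simp add: field_simps)
    moreover obtain x' where "x' \<in> C t'" "norm (x' - a i) \<le> L * (t' - b i)"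
      using L(2)[of "b i" t' "a i"] ab i t t' \<open>t' \<le> T\<close> by auto
    ultimately show ?thesis
      using i t' by auto
  qed
  then obtain i t' \<zeta>' x' where
    i: "\<And>m::nat. i m \<ge> m" and bt: "\<And>m. t < b (i m)" "\<And>m. b (i m) \<le> t' m"
      "\<And>m. t' m \<le> t + (1 + 1 / Suc m) * (b (i m) - t)" "\<And>m. t' m \<le> T"
    and \<zeta>': "\<And>m. \<zeta>' m \<in> normal_cone (C (t' m)) (x (t' m))" "\<And>m. dist (\<zeta>' m) \<zeta> < 1 / Suc m"
    and x': "\<And>m. x' m \<in> C (t' m)" "\<And>m. norm (x' m - a (i m)) \<le> L * (t' m - b (i m))"
    by metis
  define \<sigma> where "\<sigma> m = s (i m)" for m
  have \<sigma>_pos: "\<sigma> m > 0" for m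
    by (simp add: \<sigma>_def Y(2))
  have i_top: "filterlim i at_top sequentially"
    by (rule filterlim_at_top_mono[OF filterlim_ident]) (auto simp: i)
  have \<sigma>_lim: "\<sigma> \<longlonglongrightarrow> 0"
    unfolding \<sigma>_def using filterlim_compose[OF Y(4) i_top] by simp
  have qa': "(\<lambda>m. (a (i m) - x t) /\<^sub>R \<sigma> m) \<longlonglongrightarrow> w"
    unfolding \<sigma>_def using filterlim_compose[OF qa i_top] by simp
  have qb': "(\<lambda>m. (b (i m) - t) / \<sigma> m) \<longlonglongrightarrow> 1"
    unfolding \<sigma>_def using filterlim_compose[OF qb i_top] by simp
  have qt: "(\<lambda>m. (t' m - t) / \<sigma> m) \<longlonglongrightarrow> 1"
  proof (rule tendsto_sandwich[OF _ _ qb'])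
    show "\<forall>\<^sub>F m in sequentially. (b (i m) - t) / \<sigma> m \<le> (t' m - t) / \<sigma> m"
      using bt \<sigma>_pos by (intro always_eventually allI divide_right_mono) (auto simp: less_imp_le)
    show "\<forall>\<^sub>F m in sequentially. (t' m - t) / \<sigma> m \<le> (1 + 1 / Suc m) * ((b (i m) - t) / \<sigma> m)"
    proof (intro always_eventually allI)
      fix m
      have "(t' m - t) / \<sigma> m \<le> ((1 + 1 / Suc m) * (b (i m) - t)) / \<sigma> m"
        using bt(3)[of m] \<sigma>_pos[of m] by (intro divide_right_mono) auto
      then show "(t' m - t) / \<sigma> m \<le> (1 + 1 / Suc m) * ((b (i m) - t) / \<sigma> m)"
        by simp
    qed
    have "(\<lambda>m. (1 + 1 / real (Suc m)) * ((b (i m) - t) / \<sigma> m)) \<longlonglongrightarrow> (1 + 0) * 1"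
      using lim_1_over_n[THEN LIMSEQ_Suc] by (intro tendsto_intros qb') simp
    then show "(\<lambda>m. (1 + 1 / real (Suc m)) * ((b (i m) - t) / \<sigma> m)) \<longlonglongrightarrow> 1"
      by simp
  qed
  have t'_gt: "t' m > t" for m
    using bt(1,2)[of m] by simp
  have t'_lim: "t' \<longlonglongrightarrow> t"
  proof -
    have "(\<lambda>m. \<sigma> m * ((t' m - t) / \<sigma> m) + t) \<longlonglongrightarrow> 0 * 1 + t"
      by (intro tendsto_intros \<sigma>_lim qt)
    then show ?thesis
      using \<sigma>_pos by (simp add: less_imp_neq[THEN not_sym])
  qed
  have qx: "(\<lambda>m. (x (t' m) - x t) /\<^sub>R \<sigma> m) \<longlonglongrightarrow> v"
  proof -
    have "(\<lambda>m. (x (t' m) - x t) /\<^sub>R (t' m - t)) \<longlonglongrightarrow> v"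
      using t t'_gt bt(4) by (intro right_difference_quotients_tendsto[OF deriv _ _ t'_lim]) (auto intro: less_imp_le less_trans)
    then have "(\<lambda>m. ((t' m - t) / \<sigma> m) *\<^sub>R ((x (t' m) - x t) /\<^sub>R (t' m - t))) \<longlonglongrightarrow> 1 *\<^sub>R v"
      by (intro tendsto_intros qt)
    moreover have "((t' m - t) / \<sigma> m) *\<^sub>R ((x (t' m) - x t) /\<^sub>R (t' m - t)) = (x (t' m) - x t) /\<^sub>R \<sigma> m" for m
      using t'_gt[of m] by (simp add: divide_inverse)
    ultimately show ?thesis
      by (simp only: scaleR_one)
  qed
  have qx': "(\<lambda>m. (x' m - a (i m)) /\<^sub>R \<sigma> m) \<longlonglongrightarrow> 0"
  proof (rule Lim_null_comparison)
    show "\<forall>\<^sub>F m in sequentially. norm ((x' m - a (i m)) /\<^sub>R \<sigma> m) \<le> L * ((t' m - t) / \<sigma> m - (b (i m) - t) / \<sigma> m)"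
    proof (intro always_eventually allI)
      fix m
      have "norm ((x' m - a (i m)) /\<^sub>R \<sigma> m) = norm (x' m - a (i m)) / \<sigma> m"
        using \<sigma>_pos[of m] by (simp add: divide_inverse mult.commute)
      also have "\<dots> \<le> L * (t' m - b (i m)) / \<sigma> m"
        using x'(2)[of m] \<sigma>_pos[of m] by (intro divide_right_mono) auto
      finally show "norm ((x' m - a (i m)) /\<^sub>R \<sigma> m) \<le> L * ((t' m - t) / \<sigma> m - (b (i m) - t) / \<sigma> m)"
        by (simp add: diff_divide_distrib[symmetric])
    qed
    have "(\<lambda>m. L * ((t' m - t) / \<sigma> m - (b (i m) - t) / \<sigma> m)) \<longlonglongrightarrow> L * (1 - 1)"
      by (intro tendsto_intros qt qb')
    then show "(\<lambda>m. L * ((t' m - t) / \<sigma> m - (b (i m) - t) / \<sigma> m)) \<longlonglongrightarrow> 0"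
      by simp
  qed
  define q where "q m = (x' m - x (t' m)) /\<^sub>R \<sigma> m" for m
  have q_lim: "q \<longlonglongrightarrow> w - v"
  proof -
    have "(\<lambda>m. (x' m - a (i m)) /\<^sub>R \<sigma> m + (a (i m) - x t) /\<^sub>R \<sigma> m - (x (t' m) - x t) /\<^sub>R \<sigma> m) \<longlonglongrightarrow> 0 + w - v"
      by (intro tendsto_intros qx' qa' qx)
    then show ?thesis
      unfolding q_def by (simp add: scaleR_add_right[symmetric] scaleR_diff_right[symmetric])
  qed
  have \<zeta>_lim: "\<zeta>' \<longlonglongrightarrow> \<zeta>"
  proof (rule tendstoI)
    fix e :: real assume "e > 0"
    then have "\<forall>\<^sub>F m in sequentially. 1 / real (Suc m) < e"
      using lim_1_over_n[THEN LIMSEQ_Suc] by (intro order_tendstoD)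
    then show "\<forall>\<^sub>F m in sequentially. dist (\<zeta>' m) \<zeta> < e"
      by eventually_elim (use \<zeta>'(2) in \<open>meson less_trans\<close>)
  qed
  have "\<zeta>' m \<bullet> q m \<le> norm (\<zeta>' m) / (2 * r) * (\<sigma> m * (norm (q m))\<^sup>2)" for m
  proof -
    have "t' m \<in> {0..T}"
      using t t'_gt[of m] bt(4)[of m] by simp
    then have "\<zeta>' m \<bullet> (x' m - x (t' m)) \<le> norm (\<zeta>' m) / (2 * r) * (norm (x' m - x (t' m)))\<^sup>2"
      by (intro r(2)[OF _ x_in x'(1) \<zeta>'(1)])
    moreover have "x' m - x (t' m) = \<sigma> m *\<^sub>R q m"
      using \<sigma>_pos[of m] by (simp add: q_def)
    ultimately have "\<sigma> m * (\<zeta>' m \<bullet> q m) \<le> \<sigma> m * (norm (\<zeta>' m) / (2 * r) * (\<sigma> m * (norm (q m))\<^sup>2))"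
      using \<sigma>_pos[of m] by (simp add: power_mult_distrib power2_eq_square mult_ac)
    then show ?thesis
      using \<sigma>_pos[of m] by (rule mult_left_le_imp_le)
  qed
  moreover have "(\<lambda>m. \<zeta>' m \<bullet> q m) \<longlonglongrightarrow> \<zeta> \<bullet> (w - v)"
    by (intro tendsto_inner \<zeta>_lim q_lim)
  moreover have "(\<lambda>m. norm (\<zeta>' m) / (2 * r) * (\<sigma> m * (norm (q m))\<^sup>2)) \<longlonglongrightarrow> norm \<zeta> / (2 * r) * (0 * (norm (w - v))\<^sup>2)"
    using r(1) by (intro tendsto_intros \<zeta>_lim q_lim \<sigma>_lim) auto
  ultimately have "\<zeta> \<bullet> (w - v) \<le> norm \<zeta> / (2 * r) * (0 * (norm (w - v))\<^sup>2)"
    by (intro LIMSEQ_le) auto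
  then show ?thesis
    by simp
qed

text \<open>
  The hypothesis \<open>recur\<close> provides, at times \<open>t'\<close> decreasing to \<open>t\<close>, approximants of \<open>d\<close> at all step sizes
  below a bound that does not depend on \<open>t'\<close>.  Hence the step \<open>\<rho> (t' - t)\<close> is admissible at time \<open>t'\<close> once
  \<open>t'\<close> is close to \<open>t\<close>.
\<close>

lemma velocity_plus_tangent:
  fixes C :: "real \<Rightarrow> 'a::real_normed_vector set" and x :: "real \<Rightarrow> 'a"
  assumes t: "0 < t" "t < T" and x_in: "x t \<in> C t"
    and deriv: "(x has_vector_derivative v) (at t within {0..T})"
    and recur: "\<And>\<epsilon>. \<epsilon> > 0 \<Longrightarrow> \<exists>\<eta>>0. \<forall>\<kappa>>0. \<exists>t'. t < t' \<and> t' < t + \<kappa> \<and>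
      (\<forall>s. 0 < s \<longrightarrow> s < \<eta> \<longrightarrow> (\<exists>b\<in>ball d \<epsilon>. x t' + s *\<^sub>R b \<in> C t'))"
    and \<rho>: "\<rho> > 0"
  shows "(v + \<rho> *\<^sub>R d, 1) \<in> tangent_cone {y. fst y \<in> C (snd y)} (x t, t)"
proof -
  have "\<exists>t' b. t < t' \<and> t' < t + 1 / Suc m \<and> t' < T \<and> dist b d < 1 / Suc m \<and> x t' + (\<rho> * (t' - t)) *\<^sub>R b \<in> C t'" for m
  proof -
    obtain \<eta> where \<eta>: "\<eta> > 0" and acc: "\<forall>\<kappa>>0. \<exists>t'. t < t' \<and> t' < t + \<kappa> \<and>
      (\<forall>s. 0 < s \<longrightarrow> s < \<eta> \<longrightarrow> (\<exists>b\<in>ball d (1 / Suc m). x t' + s *\<^sub>R b \<in> C t'))"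
      using recur[of "1 / Suc m"] by auto
    \<comment> \<open>The bound \<open>\<eta> / \<rho>\<close> makes the step \<open>\<rho> (t' - t)\<close> smaller than \<open>\<eta>\<close>.\<close>
    define \<kappa> where "\<kappa> = min (1 / Suc m) (min (T - t) (\<eta> / \<rho>))"
    have "\<kappa> > 0"
      using t \<eta> \<rho> by (simp add: \<kappa>_def)
    then obtain t' where t': "t < t'" "t' < t + \<kappa>"
      and near: "\<forall>s. 0 < s \<longrightarrow> s < \<eta> \<longrightarrow> (\<exists>b\<in>ball d (1 / Suc m). x t' + s *\<^sub>R b \<in> C t')"
      using acc by blast
    have bounds: "t' < t + 1 / Suc m" "t' < T" "t' - t < \<eta> / \<rho>"
      using t' unfolding \<kappa>_def by linarith+
    have "0 < \<rho> * (t' - t)" "\<rho> * (t' - t) < \<eta>"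
      using bounds(3) t' \<rho> by (simp_all add: pos_less_divide_eq mult.commute)
    then obtain b where "b \<in> ball d (1 / Suc m)" "x t' + (\<rho> * (t' - t)) *\<^sub>R b \<in> C t'"
      using near by blast
    then show ?thesis
      using bounds(1,2) t'(1) by (auto simp: dist_commute)
  qed
  then obtain t' b where t': "\<And>m. t < t' m" "\<And>m. t' m < t + 1 / Suc m" "\<And>m::nat. t' m < T"
    and b: "\<And>m. dist (b m) d < 1 / Suc m" "\<And>m. x (t' m) + (\<rho> * (t' m - t)) *\<^sub>R b m \<in> C (t' m)"
    by metis
  have inv: "(\<lambda>m. 1 / real (Suc m)) \<longlonglongrightarrow> 0"
    using lim_1_over_n[THEN LIMSEQ_Suc] by simp
  have t'_diff: "(\<lambda>m. t' m - t) \<longlonglongrightarrow> 0"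
  proof (rule Lim_null_comparison[OF _ inv])
    show "\<forall>\<^sub>F m in sequentially. norm (t' m - t) \<le> 1 / Suc m"
      using t'(1,2) by (intro always_eventually allI) (smt (verit) real_norm_def)
  qed
  then have t'_lim: "t' \<longlonglongrightarrow> t"
    by (simp add: LIM_zero_iff)
  have b_lim: "b \<longlonglongrightarrow> d"
  proof (rule tendstoI)
    fix e :: real assume "e > 0"
    then have "\<forall>\<^sub>F m in sequentially. 1 / real (Suc m) < e"
      using inv by (intro order_tendstoD)
    then show "\<forall>\<^sub>F m in sequentially. dist (b m) d < e"
      by eventually_elim (use b(1) in \<open>meson less_trans\<close>)
  qed
  define Y where "Y m = (x (t' m) + (\<rho> * (t' m - t)) *\<^sub>R b m, t' m)" for m
  have quot: "(\<lambda>m. (x (t' m) - x t) /\<^sub>R (t' m - t)) \<longlonglongrightarrow> v"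
    using t t' by (intro right_difference_quotients_tendsto[OF deriv _ _ t'_lim]) (auto intro: less_imp_le less_trans)
  have Y_quot_eq: "(Y m - (x t, t)) /\<^sub>R (t' m - t) = ((x (t' m) - x t) /\<^sub>R (t' m - t) + \<rho> *\<^sub>R b m, 1)" for m
  proof -
    define h where "h = t' m - t"
    have "h \<noteq> 0"
      using t'(1)[of m] by (simp add: h_def)
    have "(x (t' m) + (\<rho> * h) *\<^sub>R b m - x t) /\<^sub>R h = ((x (t' m) - x t) + (\<rho> * h) *\<^sub>R b m) /\<^sub>R h"
      by (simp add: algebra_simps)
    also have "\<dots> = (x (t' m) - x t) /\<^sub>R h + \<rho> *\<^sub>R b m"
      using \<open>h \<noteq> 0\<close> by (simp only: scaleR_add_right scaleR_scaleR) simp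
    finally show ?thesis
      using \<open>h \<noteq> 0\<close> by (simp add: Y_def h_def[symmetric])
  qed
  have Y_quot: "(\<lambda>m. (Y m - (x t, t)) /\<^sub>R (t' m - t)) \<longlonglongrightarrow> (v + \<rho> *\<^sub>R d, 1)"
    unfolding Y_quot_eq by (intro tendsto_intros quot b_lim)
  have "(\<lambda>m. (t' m - t) *\<^sub>R ((Y m - (x t, t)) /\<^sub>R (t' m - t)) + (x t, t)) \<longlonglongrightarrow> 0 *\<^sub>R (v + \<rho> *\<^sub>R d, 1) + (x t, t)"
    by (intro tendsto_add tendsto_scaleR t'_diff Y_quot tendsto_const)
  moreover have "(t' m - t) *\<^sub>R ((Y m - (x t, t)) /\<^sub>R (t' m - t)) + (x t, t) = Y m" for m
    using t'(1)[of m] by simp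
  ultimately have Y_lim: "Y \<longlonglongrightarrow> (x t, t)"
    by simp
  have "Y m \<in> {y. fst y \<in> C (snd y)}" for m
    using b(2) by (simp add: Y_def)
  then show ?thesis
    unfolding tangent_cone_def using x_in t'(1) Y_lim t'_diff Y_quot
    by (auto intro!: exI[of _ Y] exI[of _ "\<lambda>m. t' m - t"])
qed

lemma minimal_velocity_imp_normal:
  fixes C :: "'a::real_inner set"
  assumes "p \<in> C"
    and min: "\<And>d \<rho>. \<lbrakk>d \<in> tangent_cone C p; \<rho> > 0\<rbrakk> \<Longrightarrow> norm (v - a) \<le> norm (v + \<rho> *\<^sub>R d - a)"
  shows "a - v \<in> normal_cone C p"
  unfolding normal_cone_def
proof (intro CollectI conjI ballI)
  fix d assume d: "d \<in> tangent_cone C p"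
  have le: "(a - v) \<bullet> d \<le> \<rho> * ((norm d)\<^sup>2 / 2)" if \<rho>: "\<rho> > 0" for \<rho>
  proof -
    have "(norm (v - a))\<^sup>2 \<le> (norm (v + \<rho> *\<^sub>R d - a))\<^sup>2"
      using min[OF d \<rho>] by (intro power_mono) auto
    also have "v + \<rho> *\<^sub>R d - a = \<rho> *\<^sub>R d - (a - v)"
      by simp
    also have "(norm (\<rho> *\<^sub>R d - (a - v)))\<^sup>2 = \<rho>\<^sup>2 * (norm d)\<^sup>2 - 2 * \<rho> * ((a - v) \<bullet> d) + (norm (a - v))\<^sup>2"
      unfolding power2_norm_eq_inner inner_diff_left[of "\<rho> *\<^sub>R d" "a - v"] inner_diff_right[of _ "\<rho> *\<^sub>R d" "a - v"]
      by (simp add: inner_commute power2_eq_square)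
    finally have "\<rho> * (2 * ((a - v) \<bullet> d)) \<le> \<rho> * (\<rho> * (norm d)\<^sup>2)"
      by (simp add: norm_minus_commute power2_eq_square mult_ac)
    then have "2 * ((a - v) \<bullet> d) \<le> \<rho> * (norm d)\<^sup>2"
      using \<rho> by (rule mult_left_le_imp_le)
    then show ?thesis
      by simp
  qed
  have "((\<lambda>\<rho>. \<rho> * ((norm d)\<^sup>2 / 2)) \<longlongrightarrow> 0 * ((norm d)\<^sup>2 / 2)) (at_right 0)"
    by (intro tendsto_intros)
  then have "(a - v) \<bullet> d \<le> 0 * ((norm d)\<^sup>2 / 2)"
  proof (rule tendsto_lowerbound)
    show "\<forall>\<^sub>F \<rho> in at_right 0. (a - v) \<bullet> d \<le> \<rho> * ((norm d)\<^sup>2 / 2)"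
      using eventually_at_right_less by eventually_elim (rule le)
  qed simp
  then show "(a - v) \<bullet> d \<le> 0"
    by simp
qed (rule assms(1))

section \<open>The extended projection\<close>

lemma E_space_eq: "E_space = range (\<lambda>z :: real^'n. (z, 0::real))"
proof -
  have E: "E_map z = (z, 0)" for z :: "real^'n"
  proof (rule prod_eqI)
    have "fst (E_map z) = (\<Sum>i\<in>UNIV. z $ i *\<^sub>R axis i 1)"
      by (simp add: E_map_def fst_sum)
    then show "fst (E_map z) = fst (z, 0::real)"
      by (simp add: basis_expansion scalar_mult_eq_scaleR[symmetric])
  qed (simp add: E_map_def snd_sum)
  have "adjoint E_map = (fst :: (real^'n) \<times> real \<Rightarrow> real^'n)"
    by (rule adjoint_unique) (simp add: E inner_prod_def)
  then show ?thesis
    by (force simp: E_space_def E)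
qed

text \<open>
  The hypothesis is the variational inequality for \<open>v\<close>; it forces a unique minimiser although \<open>K\<close> need
  not be convex.
\<close>

lemma ext_proj_E_space_eq:
  fixes K :: "((real^'n) \<times> real) set"
  assumes "(v, 1) \<in> K" and "\<And>w. (w, 1) \<in> K \<Longrightarrow> (a - v) \<bullet> (w - v) \<le> 0"
  shows "ext_proj K E_space (a, 1) = {(v, 1)}"
proof -
  have feas: "w \<in> K \<and> w - (a, 1) \<in> E_space \<longleftrightarrow> (fst w, 1) \<in> K \<and> snd w = 1" for w :: "(real^'n) \<times> real"
    by (cases w) (auto simp: E_space_eq)
  have dist: "(norm (v - a))\<^sup>2 + (norm (w - v))\<^sup>2 \<le> (norm (w - a))\<^sup>2" if "(w, 1) \<in> K" for w
  proof -
    define p q where "p = w - v" and "q = a - v"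
    have eqs: "w - a = p - q" "w - v = p" "a - v = q" "norm (v - a) = norm q"
      by (simp_all add: p_def q_def norm_minus_commute)
    have "(norm (p - q))\<^sup>2 = (norm p)\<^sup>2 - 2 * (q \<bullet> p) + (norm q)\<^sup>2"
      unfolding power2_norm_eq_inner by (simp add: inner_diff_left inner_diff_right inner_commute)
    then show ?thesis
      using assms(2)[OF that] unfolding eqs by simp
  qed
  show ?thesis
  proof (intro equalityI subsetI)
    fix w assume "w \<in> ext_proj K E_space (a, 1)"
    then have w: "(fst w, 1) \<in> K" "snd w = 1"
      and "\<not> 1 / 2 * (norm ((v, 1) - (a, 1)))\<^sup>2 < 1 / 2 * (norm (w - (a, 1)))\<^sup>2"
      using assms(1) feas feas[of "(v, 1)"] unfolding ext_proj_def is_arg_min_def by auto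
    then have "(norm (fst w - a))\<^sup>2 \<le> (norm (v - a))\<^sup>2"
      by (cases w) (auto simp: norm_Pair not_less)
    with dist[OF w(1)] have "(norm (fst w - v))\<^sup>2 \<le> 0"
      by linarith
    then show "w \<in> {(v, 1)}"
      using w(2) by (cases w) simp
  next
    fix w assume "w \<in> {(v, 1::real)}"
    moreover have "(norm (v - a))\<^sup>2 \<le> (norm (fst w' - a))\<^sup>2" if "(fst w', 1) \<in> K" for w'
      using dist[OF that] zero_le_power2[of "norm (fst w' - v)"] by linarith
    ultimately show "w \<in> ext_proj K E_space (a, 1)"
      using assms(1) unfolding ext_proj_def is_arg_min_def feas
      by (auto simp: norm_Pair not_less)
  qed
qed

lemma ext_proj_E_spaceD:
  fixes K :: "((real^'n) \<times> real) set"
  assumes "w \<in> ext_proj K E_space (a, 1)"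
  shows "snd w = 1" "\<And>w'. (w', 1) \<in> K \<Longrightarrow> norm (fst w - a) \<le> norm (w' - a)"
proof -
  have feas: "w \<in> K \<and> w - (a, 1) \<in> E_space \<longleftrightarrow> (fst w, 1) \<in> K \<and> snd w = 1" for w :: "(real^'n) \<times> real"
    by (cases w) (auto simp: E_space_eq)
  show w: "snd w = 1"
    using assms feas unfolding ext_proj_def is_arg_min_def by blast
  fix w' assume w': "(w', 1) \<in> K"
  have min: "\<not> 1 / 2 * (norm (y - (a, 1)))\<^sup>2 < 1 / 2 * (norm (w - (a, 1)))\<^sup>2"
    if "y \<in> K \<and> y - (a, 1) \<in> E_space" for y
    using assms that unfolding ext_proj_def is_arg_min_def by blast
  have "\<not> 1 / 2 * (norm ((w', 1::real) - (a, 1)))\<^sup>2 < 1 / 2 * (norm (w - (a, 1)))\<^sup>2"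
    by (rule min) (unfold feas, simp add: w')
  then have "(norm (fst w - a))\<^sup>2 \<le> (norm (w' - a))\<^sup>2"
    using w by (cases w) (auto simp: norm_Pair not_less)
  then show "norm (fst w - a) \<le> norm (w' - a)"
    by (simp add: abs_le_square_iff[symmetric])
qed

section \<open>Sweeping processes and extended projected dynamical systems\<close>

lemma closed_moving_set:
  assumes "continuously_differentiable (\<lambda>z. c z t)"
  shows "closed (moving_set c t)"
proof -
  have "continuous_on UNIV (\<lambda>z. c z t)"
    using assms unfolding continuously_differentiable_def
    by (meson continuous_at_imp_continuous_on has_derivative_continuous)
  then have "closed {z. 0 \<le> c z t $ i}" for i
    by (intro closed_Collect_le continuous_intros) auto
  then have "closed (\<Inter>i. {z. 0 \<le> c z t $ i})"
    by blast
  also have "(\<Inter>i. {z. 0 \<le> c z t $ i}) = moving_set c t"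
    by (auto simp: moving_set_def less_eq_vec_def)
  finally show ?thesis .
qed

lemma extended_set_eq: "extended_set c = {y. fst y \<in> moving_set c (snd y)}"
  by (simp add: extended_set_def c_hat_def moving_set_def)

lemma sweeping_imp_epds:
  fixes c :: "real^'n \<Rightarrow> real \<Rightarrow> real^'k" and x :: "real \<Rightarrow> real^'n"
  assumes lip: "forward_lipschitz T (moving_set c)"
    and prox: "uniformly_prox_regular T (moving_set c)"
    and sol: "sweeping_solution T f u (moving_set c) x"
  shows "epds_solution T f u (extended_set c) (x 0) (\<lambda>t. (x t, t))"
  unfolding epds_solution_def extended_set_eq
proof (intro conjI ballI)
  let ?C = "moving_set c" and ?D = "{y. fst y \<in> moving_set c (snd y)}"
  have ac: "absolutely_continuous_on {0..T} x"
    and x_in: "\<And>t. t \<in> {0..T} \<Longrightarrow> x t \<in> ?C t" and x0: "x 0 \<in> ?C 0"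
    and incl: "AE t in lborel. t \<in> {0..T} \<longrightarrow>
        (\<exists>v. (x has_vector_derivative v) (at t within {0..T}) \<and>
             v \<in> {f (x t, u t) - \<zeta> | \<zeta>. \<zeta> \<in> normal_cone (?C t) (x t)})"
    using sol unfolding sweeping_solution_def by auto
  show "absolutely_continuous_on {0..T} (\<lambda>t. (x t, t))"
    by (rule absolutely_continuous_on_dominated[OF ac, of _ 1])
      (auto simp: intro: order_trans[OF norm_Pair_le])
  show "(x t, t) \<in> ?D" if "t \<in> {0..T}" for t
    using x_in[OF that] by simp
  show "(x 0, 0) = (x 0, 0)" "(x 0, 0) \<in> ?D"
    using x0 by simp_all
  show "AE t in lborel. t \<in> {0..T} \<longrightarrow>
      (\<exists>v. ((\<lambda>t. (x t, t)) has_vector_derivative v) (at t within {0..T}) \<and>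
        ext_proj (tangent_cone ?D (x t, t)) E_space (f (fst (x t, t), u t), 1) = {v})"
    using incl AE_right_recurrent[of "\<lambda>t. normal_cone (?C t) (x t)"] AE_lborel_singleton[of 0] AE_lborel_singleton[of T]
  proof eventually_elim
    fix t
    assume incl: "t \<in> {0..T} \<longrightarrow> (\<exists>v. (x has_vector_derivative v) (at t within {0..T}) \<and>
             v \<in> {f (x t, u t) - \<zeta> | \<zeta>. \<zeta> \<in> normal_cone (?C t) (x t)})"
      and recur: "\<forall>p\<in>normal_cone (?C t) (x t). \<forall>\<epsilon>>0. \<forall>\<delta>>0. \<exists>\<eta>>0. \<forall>h. 0 < h \<longrightarrow> h < \<eta> \<longrightarrow>
           (\<exists>t'\<in>{t + h..t + (1 + \<delta>) * h}. \<exists>p'\<in>normal_cone (?C t') (x t'). dist p' p < \<epsilon>)"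
      and "t \<noteq> 0" "t \<noteq> T"
    show "t \<in> {0..T} \<longrightarrow>
      (\<exists>v. ((\<lambda>t. (x t, t)) has_vector_derivative v) (at t within {0..T}) \<and>
        ext_proj (tangent_cone ?D (x t, t)) E_space (f (fst (x t, t), u t), 1) = {v})"
    proof
      assume t_in: "t \<in> {0..T}"
      then have t: "0 < t" "t < T"
        using \<open>t \<noteq> 0\<close> \<open>t \<noteq> T\<close> by auto
      obtain v \<zeta> where v: "(x has_vector_derivative v) (at t within {0..T})" "v = f (x t, u t) - \<zeta>"
        and \<zeta>: "\<zeta> \<in> normal_cone (?C t) (x t)"
        using incl t_in by blast
      \<comment> \<open>The trajectory itself shows that its velocity is feasible: take the tangent direction 0.\<close>
      have "(v + 1 *\<^sub>R 0, 1) \<in> tangent_cone ?D (x t, t)"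
      proof (rule velocity_plus_tangent[where x=x and t=t and C="?C", OF t x_in[OF t_in] v(1)])
        fix \<epsilon> :: real assume "\<epsilon> > 0"
        show "\<exists>\<eta>>0. \<forall>\<kappa>>0. \<exists>t'. t < t' \<and> t' < t + \<kappa> \<and>
          (\<forall>s. 0 < s \<longrightarrow> s < \<eta> \<longrightarrow> (\<exists>b\<in>ball 0 \<epsilon>. x t' + s *\<^sub>R b \<in> ?C t'))"
        proof (rule exI[of _ 1], intro conjI allI impI)
          fix \<kappa> :: real assume "\<kappa> > 0"
          define t' where "t' = t + min \<kappa> (T - t) / 2"
          have "t < t'" "t' < t + \<kappa>" "t' \<in> {0..T}"
            using t \<open>\<kappa> > 0\<close> by (auto simp: t'_def min_def field_simps)
          moreover have "\<exists>b\<in>ball 0 \<epsilon>. x t' + s *\<^sub>R b \<in> ?C t'" for s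
            using x_in[OF \<open>t' \<in> {0..T}\<close>] \<open>\<epsilon> > 0\<close> by (intro bexI[of _ 0]) auto
          ultimately show "\<exists>t'. t < t' \<and> t' < t + \<kappa> \<and>
            (\<forall>s. 0 < s \<longrightarrow> s < 1 \<longrightarrow> (\<exists>b\<in>ball 0 \<epsilon>. x t' + s *\<^sub>R b \<in> ?C t'))"
            by blast
        qed simp
      qed simp
      then have feasible: "(v, 1) \<in> tangent_cone ?D (x t, t)"
        by simp
      have "(f (x t, u t) - v) \<bullet> (w - v) \<le> 0" if "(w, 1) \<in> tangent_cone ?D (x t, t)" for w
      proof -
        have "\<zeta> \<bullet> (w - v) \<le> 0"
          using recur \<zeta> by (intro normal_velocity_inequality[where x=x and t=t and C="?C", OF t x_in v(1) lip prox _ that]) auto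
        then show ?thesis
          using v(2) by simp
      qed
      with feasible have "ext_proj (tangent_cone ?D (x t, t)) E_space (f (x t, u t), 1) = {(v, 1)}"
        by (rule ext_proj_E_space_eq)
      moreover have "((\<lambda>t. (x t, t)) has_vector_derivative (v, 1)) (at t within {0..T})"
        using v(1) by (intro has_vector_derivative_Pair) auto
      ultimately show "\<exists>v. ((\<lambda>t. (x t, t)) has_vector_derivative v) (at t within {0..T}) \<and>
        ext_proj (tangent_cone ?D (x t, t)) E_space (f (fst (x t, t), u t), 1) = {v}"
        by auto
    qed
  qed
qed

lemma epds_imp_sweeping:
  fixes c :: "real^'n \<Rightarrow> real \<Rightarrow> real^'k" and x :: "real \<Rightarrow> real^'n"
  assumes closed: "\<And>t. closed (moving_set c t)"
    and prox: "uniformly_prox_regular T (moving_set c)"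
    and sol: "epds_solution T f u (extended_set c) (x 0) (\<lambda>t. (x t, \<tau> t))"
  shows "sweeping_solution T f u (moving_set c) x"
  unfolding sweeping_solution_def
proof (intro conjI ballI)
  let ?C = "moving_set c" and ?D = "{y. fst y \<in> moving_set c (snd y)}"
  obtain r where r: "r > 0" "\<And>t p y \<zeta>. \<lbrakk>t \<in> {0..T}; p \<in> ?C t; y \<in> ?C t; \<zeta> \<in> normal_cone (?C t) p\<rbrakk>
      \<Longrightarrow> \<zeta> \<bullet> (y - p) \<le> norm \<zeta> / (2 * r) * (norm (y - p))\<^sup>2"
    using prox unfolding uniformly_prox_regular_def by blast
  have ac: "absolutely_continuous_on {0..T} (\<lambda>t. (x t, \<tau> t))"
    and y_in: "\<And>t. t \<in> {0..T} \<Longrightarrow> x t \<in> ?C (\<tau> t)" and y0: "\<tau> 0 = 0" "x 0 \<in> ?C (\<tau> 0)"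
    and eqn: "AE t in lborel. t \<in> {0..T} \<longrightarrow>
        (\<exists>v. ((\<lambda>t. (x t, \<tau> t)) has_vector_derivative v) (at t within {0..T}) \<and>
             ext_proj (tangent_cone ?D (x t, \<tau> t)) E_space (f (x t, u t), 1) = {v})"
    using sol unfolding epds_solution_def extended_set_eq by auto
  have le_pair: "norm a \<le> norm (a, b)" "norm b \<le> norm (a, b)" for a :: "real^'n" and b :: real
    by (rule norm_fst_le norm_snd_le)+
  show "absolutely_continuous_on {0..T} x"
    by (rule absolutely_continuous_on_dominated[OF ac, of _ 0]) (auto intro: le_pair)
  have "absolutely_continuous_on {0..T} \<tau>"
    by (rule absolutely_continuous_on_dominated[OF ac, of _ 0]) (auto intro: le_pair(2)[unfolded real_norm_def])
  moreover have "AE t in lborel. t \<in> {0..T} \<longrightarrow> (\<tau> has_vector_derivative 1) (at t within {0..T})"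
    using eqn
  proof eventually_elim
    case (elim t)
    show ?case
    proof
      assume "t \<in> {0..T}"
      then obtain v where v: "((\<lambda>t. (x t, \<tau> t)) has_vector_derivative v) (at t within {0..T})"
        "v \<in> ext_proj (tangent_cone ?D (x t, \<tau> t)) E_space (f (x t, u t), 1)"
        using elim by auto
      have "(\<tau> has_vector_derivative snd v) (at t within {0..T})"
        using bounded_linear.has_vector_derivative[OF bounded_linear_snd v(1)] by simp
      then show "(\<tau> has_vector_derivative 1) (at t within {0..T})"
        using ext_proj_E_spaceD(1)[OF v(2)] by simp
    qed
  qed
  ultimately have \<tau>: "\<tau> t = t" if "t \<in> {0..T}" for t
    using absolutely_continuous_on_unit_speed y0(1) that by blast
  show x_in: "x t \<in> ?C t" if "t \<in> {0..T}" for t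
    using y_in[OF that] \<tau>[OF that] by simp
  show "x 0 \<in> ?C 0"
    using y0 by simp
  show "AE t in lborel. t \<in> {0..T} \<longrightarrow>
        (\<exists>v. (x has_vector_derivative v) (at t within {0..T}) \<and>
             v \<in> {f (x t, u t) - \<zeta> | \<zeta>. \<zeta> \<in> normal_cone (?C t) (x t)})"
    using eqn AE_derivable_recurrent[of x ?C] AE_lborel_singleton[of 0] AE_lborel_singleton[of T]
  proof eventually_elim
    case (elim t)
    show ?case
    proof
      assume t_in: "t \<in> {0..T}"
      then have t: "0 < t" "t < T"
        using elim(3,4) by auto
      obtain w where w: "((\<lambda>t. (x t, \<tau> t)) has_vector_derivative w) (at t within {0..T})"
        "w \<in> ext_proj (tangent_cone ?D (x t, t)) E_space (f (x t, u t), 1)"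
        using elim(1) t_in \<tau>[OF t_in] by auto
      define v where "v = fst w"
      have v: "(x has_vector_derivative v) (at t within {0..T})"
        using bounded_linear.has_vector_derivative[OF bounded_linear_fst w(1)] by (simp add: v_def)
      have "f (x t, u t) - v \<in> normal_cone (?C t) (x t)"
      proof (rule minimal_velocity_imp_normal[OF x_in[OF t_in]])
        fix d and \<rho> :: real
        assume d: "d \<in> tangent_cone (?C t) (x t)" and \<rho>: "\<rho> > 0"
        have "\<exists>\<eta>>0. \<forall>s. 0 < s \<longrightarrow> s < \<eta> \<longrightarrow> (\<exists>b\<in>ball d \<epsilon>. x t + s *\<^sub>R b \<in> ?C t)" if "\<epsilon> > 0" for \<epsilon>
          using prox_regular_tangent_derivable[OF closed r(1) r(2)[OF t_in] d that] .
        then have "(v + \<rho> *\<^sub>R d, 1) \<in> tangent_cone ?D (x t, t)"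
          using elim(2) by (intro velocity_plus_tangent[where x=x and t=t and C="?C", OF t x_in[OF t_in] v _ \<rho>]) blast
        then show "norm (v - f (x t, u t)) \<le> norm (v + \<rho> *\<^sub>R d - f (x t, u t))"
          unfolding v_def by (rule ext_proj_E_spaceD(2)[OF w(2)])
      qed
      then have "v \<in> {f (x t, u t) - \<zeta> | \<zeta>. \<zeta> \<in> normal_cone (?C t) (x t)}"
        by (auto intro!: exI[of _ "f (x t, u t) - v"])
      with v show "\<exists>v. (x has_vector_derivative v) (at t within {0..T}) \<and>
             v \<in> {f (x t, u t) - \<zeta> | \<zeta>. \<zeta> \<in> normal_cone (?C t) (x t)}"
        by blast
    qed
  qed
qed

theorem theorem4:
  fixes T :: real
    and f :: "(real^'n) \<times> (real^'m) \<Rightarrow> real^'n"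
    and u :: "real \<Rightarrow> real^'m"
    and c :: "real^'n \<Rightarrow> real \<Rightarrow> real^'k"
    and x :: "real \<Rightarrow> real^'n"
  assumes "0 \<le> T"
    and "continuously_differentiable f"
    and "\<And>t. continuously_differentiable (\<lambda>z. c z t)"
    and "\<And>z. \<exists>L. L-lipschitz_on UNIV (\<lambda>t. c z t)"
    and "normals_by_gradients T c"
    and "forward_lipschitz T (moving_set c)"
    and "uniformly_prox_regular T (moving_set c)"
    and "of_bounded_variation T (moving_set c)"
  shows "sweeping_solution T f u (moving_set c) x \<longleftrightarrow>
         (\<exists>\<tau> :: real \<Rightarrow> real. epds_solution T f u (extended_set c) (x 0) (\<lambda>t. (x t, \<tau> t)))"
proof
  assume "sweeping_solution T f u (moving_set c) x"
  then have time: "epds_solution T f u (extended_set c) (x 0) (\<lambda>t. (x t, t))"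
    by (rule sweeping_imp_epds[OF assms(6,7)])
  show "\<exists>\<tau>. epds_solution T f u (extended_set c) (x 0) (\<lambda>t. (x t, \<tau> t))"
    by (rule exI[where x="\<lambda>t. t"], rule time)
next
  assume "\<exists>\<tau>. epds_solution T f u (extended_set c) (x 0) (\<lambda>t. (x t, \<tau> t))"
  then show "sweeping_solution T f u (moving_set c) x"
    using epds_imp_sweeping[OF closed_moving_set[OF assms(3)] assms(7)] by blast
qed

end
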